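(* Let $G,H$ be groups equipped with conjugation-invariant norms, let $T$ be a scaling set, and let $\pi\colon G\to H$ be a metric quotient with bounded kernel. Then $\hat{\mathcal{C}}(\pi)\colon\hat{\mathcal{C}}(G,T)\to\hat{\mathcal{C}}(H,T)$, $[g]\mapsto[\pi\circ g]$, is an isometry.
   Context: Norms. A norm on a group $G$ is a function $\|\cdot\|\colon G\to[0,\infty)$ with $\|g\|=0\iff g=1$, $\|g^{-1}\|=\|g\|$ and $\|gh\|\le\|g\|+\|h\|$; for a pseudonorm one only requires $\|1\|=0$ instead of the first condition. It is conjugation-invariant if $\|hgh^{-1}\|=\|g\|$ for all $g,h$. It induces the bi-invariant (pseudo)metric $d(g,h)=\|g^{-1}h\|$; all metric notions refer to it. A homomorphism $\varphi$ is Lipschitz with constant $C$ iff $\|\varphi(g)\|\le C\|g\|$ for all $g$. A surjective homomorphism $\pi\colon G\to H$ of groups with conjugation-invariant (pseudo)norms is a metric quotient if $\|h\|_H=\inf\{\|g\|_G: g\in\pi^{-1}(h)\}$ for all $h\in H$. The groups $F_{\mathbb{R}}(G)$ and $F(G)$. Let $G$ be a group with a conjugation-invariant norm. $F_{\mathbb{R}}(G)$ is the free product of copies of the additive group $\mathbb{R}$ indexed by the elements $g$ of the set $G$; the element $r$ of the copy indexed by $g$ is written $\overline{g}(r)$. It carries the conjugation-invariant pseudonorm $$\|x\|=\inf\Big\{\sum_{i=1}^n |r_i|\,\|g_i\| : x=\prod_{i=1}^n h_i\,\overline{g_i}(r_i)^{\pm1}h_i^{-1},\ h_i\in F_{\mathbb{R}}(G)\Big\}.$$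 $F(G)\le F_{\mathbb{R}}(G)$ is the subgroup generated by the elements $\overline{g}:=\overline{g}(1)$; it is free on $\{\overline{g}: g\in G\}$. For $t\in\mathbb{R}$, $\psi_t\colon F_{\mathbb{R}}(G)\to F_{\mathbb{R}}(G)$ is the homomorphism with $\psi_t(\overline{g}(r))=\overline{g}(tr)$. $\pi_G\colon F(G)\to G$ is the homomorphism with $\pi_G(\overline{g})=g$. Directional asymptotic cone. A scaling set is an unbounded subset $T\subseteq(0,\infty)$; limits over $t\in T$ are taken as $t\to\infty$. A function $f$ from $T$ to a pseudometric space is Cauchy if for every $\epsilon>0$, $d(f(t),f(t'))<\epsilon$ for all sufficiently large $t,t'\in T$. $\mathcal{D}(G,T)$ is the group (pointwise product) of all functions $w\colon T\to F(G)$ such that $t\mapsto\psi_{1/t}(w(t))\in F_{\mathbb{R}}(G)$ is Cauchy, with pseudonorm $\|w\|=\lim_{t\in T}\|\psi_{1/t}(w(t))\|$. $\mathcal{C}(G,T)=\{\pi_G\circ w: w\in\mathcal{D}(G,T)\}$, a group of functions $T\to G$, with pseudonorm $\|g\|=\inf\{\|w\|: w\in\mathcal{D}(G,T),\ \pi_G\circ w=g\}$. The directional asymptotic cone $\hat{\mathcal{C}}(G,T)$ is the quotient of $\mathcal{C}(G,T)$ by the normal subgroup of elements of pseudonorm $0$, with the induced conjugation-invariant norm; $[g]$ denotes the class of $g$. Any Lipschitz homomorphism $\varphi\colon G\to H$ induces a well-defined Lipschitz homomorphism $\hat{\mathcal{C}}(\varphi)\colon\hat{\mathcal{C}}(G,T)\to\hat{\mathcal{C}}(H,T)$,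 $[g]\mapsto[\varphi\circ g]$. *)

theory Defs
  imports Complex_Main "HOL-Algebra.Algebra"
begin

section \<open>Norms on groups\<close>

definition conj_inv_norm :: "('a, 'm) monoid_scheme \<Rightarrow> ('a \<Rightarrow> real) \<Rightarrow> bool" where
  "conj_inv_norm G \<nu> \<longleftrightarrow>
     (\<forall>g\<in>carrier G. 0 \<le> \<nu> g) \<and>
     (\<forall>g\<in>carrier G. \<nu> g = 0 \<longleftrightarrow> g = \<one>\<^bsub>G\<^esub>) \<and>
     (\<forall>g\<in>carrier G. \<nu> (inv\<^bsub>G\<^esub> g) = \<nu> g) \<and>
     (\<forall>g\<in>carrier G. \<forall>h\<in>carrier G. \<nu> (g \<otimes>\<^bsub>G\<^esub> h) \<le> \<nu> g + \<nu> h) \<and>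
     (\<forall>g\<in>carrier G. \<forall>h\<in>carrier G. \<nu> (h \<otimes>\<^bsub>G\<^esub> g \<otimes>\<^bsub>G\<^esub> inv\<^bsub>G\<^esub> h) = \<nu> g)"

definition norm_dist :: "('a, 'm) monoid_scheme \<Rightarrow> ('a \<Rightarrow> real) \<Rightarrow> 'a \<Rightarrow> 'a \<Rightarrow> real" where
  "norm_dist G \<nu> g h = \<nu> (inv\<^bsub>G\<^esub> g \<otimes>\<^bsub>G\<^esub> h)"

definition metric_quotient ::
  "('a, 'm) monoid_scheme \<Rightarrow> ('a \<Rightarrow> real) \<Rightarrow> ('b, 'n) monoid_scheme \<Rightarrow> ('b \<Rightarrow> real) \<Rightarrow> ('a \<Rightarrow> 'b) \<Rightarrow> bool"
  where "metric_quotient G \<nu> H \<mu> \<pi> \<longleftrightarrow>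
     \<pi> \<in> epi G H \<and> (\<forall>h\<in>carrier H. \<mu> h = Inf {\<nu> g | g. g \<in> carrier G \<and> \<pi> g = h})"

definition bounded_kernel ::
  "('a, 'm) monoid_scheme \<Rightarrow> ('a \<Rightarrow> real) \<Rightarrow> ('b, 'n) monoid_scheme \<Rightarrow> ('a \<Rightarrow> 'b) \<Rightarrow> bool" where
  "bounded_kernel G \<nu> H \<pi> \<longleftrightarrow> (\<exists>K. \<forall>g\<in>kernel G H \<pi>. \<nu> g \<le> K)"

text \<open>An isometry is a distance-preserving bijection, for the metrics induced by the norms.\<close>

definition isometry ::
  "('a, 'm) monoid_scheme \<Rightarrow> ('a \<Rightarrow> real) \<Rightarrow> ('b, 'n) monoid_scheme \<Rightarrow> ('b \<Rightarrow> real) \<Rightarrow> ('a \<Rightarrow> 'b) \<Rightarrow> bool"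
  where "isometry G \<nu> H \<mu> f \<longleftrightarrow>
     bij_betw f (carrier G) (carrier H) \<and>
     (\<forall>x\<in>carrier G. \<forall>y\<in>carrier G. norm_dist H \<mu> (f x) (f y) = norm_dist G \<nu> x y)"


section \<open>The free product of copies of the additive reals\<close>

text \<open>An element of the free product is represented by its normal form, a list of syllables
  \<open>(g, r)\<close> with nonzero \<open>r\<close> and distinct neighbouring indices.  The function \<open>push\<close> multiplies
  a normal form from the left by one (possibly trivial) syllable.\<close>

type_synonym 'a word = "('a \<times> real) list"

definition reduced :: "'a word \<Rightarrow> bool" where
  "reduced w \<longleftrightarrow> (\<forall>p\<in>set w. snd p \<noteq> 0) \<and> distinct_adj (map fst w)"

fun push :: "'a \<times> real \<Rightarrow> 'a word \<Rightarrow> 'a word" where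
  "push (g, r) [] = (if r = 0 then [] else [(g, r)])"
| "push (g, r) ((h, s) # w) =
     (if r = 0 then (h, s) # w
      else if g = h then (if r + s = 0 then w else (g, r + s) # w)
      else (g, r) # (h, s) # w)"

definition FR :: "('a, 'm) monoid_scheme \<Rightarrow> 'a word monoid" where
  "FR G = \<lparr>carrier = {w. reduced w \<and> fst ` set w \<subseteq> carrier G},
           monoid.mult = (\<lambda>v w. foldr push v w), one = []\<rparr>"

definition syl :: "'a \<Rightarrow> real \<Rightarrow> 'a word" where
  "syl g r = push (g, r) []"

text \<open>The empty product is the unit.  In the norm below each summand comes from a quadruple
  consisting of the conjugator, the index, the real number and the exponent \<open>\<plusminus>1\<close>.\<close>

definition FR_norm :: "('a, 'm) monoid_scheme \<Rightarrow> ('a \<Rightarrow> real) \<Rightarrow> 'a word \<Rightarrow> real" where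
  "FR_norm G \<nu> x = Inf {sum_list (map (\<lambda>(h, g, r, e). \<bar>r\<bar> * \<nu> g) L) | L :: ('a word \<times> 'a \<times> real \<times> int) list.
     set L \<subseteq> carrier (FR G) \<times> carrier G \<times> UNIV \<times> {1, -1} \<and>
     x = foldr (\<lambda>(h, g, r, e) y. (h \<otimes>\<^bsub>FR G\<^esub> (syl g r [^]\<^bsub>FR G\<^esub> e) \<otimes>\<^bsub>FR G\<^esub> inv\<^bsub>FR G\<^esub> h) \<otimes>\<^bsub>FR G\<^esub> y)
           L \<one>\<^bsub>FR G\<^esub>}"

text \<open>Extension of a family of maps on the syllables to words.\<close>

definition word_eval :: "('c, 'm) monoid_scheme \<Rightarrow> ('a \<Rightarrow> real \<Rightarrow> 'c) \<Rightarrow> 'a word \<Rightarrow> 'c" where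
  "word_eval M f w = foldr (\<lambda>(g, r) y. f g r \<otimes>\<^bsub>M\<^esub> y) w \<one>\<^bsub>M\<^esub>"

definition \<psi> :: "('a, 'm) monoid_scheme \<Rightarrow> real \<Rightarrow> 'a word \<Rightarrow> 'a word" where
  "\<psi> G t = word_eval (FR G) (\<lambda>g r. syl g (t * r))"

definition F_grp :: "('a, 'm) monoid_scheme \<Rightarrow> 'a word monoid" where
  "F_grp G = (FR G)\<lparr>carrier := generate (FR G) {syl g 1 | g. g \<in> carrier G}\<rparr>"

text \<open>The syllables of an element of \<open>F_grp G\<close> have integral exponents, so the floor only converts
  types here; \<open>\<pi>\<^sub>F\<close> is meaningful only on \<open>carrier (F_grp G)\<close>.\<close>

definition \<pi>\<^sub>F :: "('a, 'm) monoid_scheme \<Rightarrow> 'a word \<Rightarrow> 'a" where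
  "\<pi>\<^sub>F G = word_eval G (\<lambda>g r. g [^]\<^bsub>G\<^esub> \<lfloor>r\<rfloor>)"


subsection \<open>The normal forms are a model of the free product\<close>

lemma reduced_push: "reduced w \<Longrightarrow> reduced (push p w)"
  by (cases "(p, w)" rule: push.cases)
     (auto simp: reduced_def distinct_adj_Cons split: list.splits)

lemma fst_push: "fst ` set (push p w) \<subseteq> insert (fst p) (fst ` set w)"
  by (cases "(p, w)" rule: push.cases) auto

lemma push_zero: "push (g, 0) w = w"
  by (cases "((g, 0::real), w)" rule: push.cases) auto

lemma push_push_same:
  assumes "reduced w"
  shows "push (g, r) (push (g, s) w) = push (g, r + s) w"
proof (cases w)
  case Nil
  then show ?thesis by auto
next
  case (Cons p v)
  obtain h t where p: "p = (h, t)" by fastforce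
  show ?thesis
    using assms unfolding Cons p
    by (cases v) (auto simp: reduced_def add.assoc split: if_splits)
qed

lemma reduced_foldr: "reduced w \<Longrightarrow> reduced (foldr push v w)"
  by (induction v) (auto intro: reduced_push)

lemma foldr_push_push:
  assumes "reduced v" "reduced w"
  shows "foldr push (push p v) w = push p (foldr push v w)"
proof -
  obtain g r where p: "p = (g, r)" by fastforce
  show ?thesis
  proof (cases v)
    case Nil
    then show ?thesis using assms by (auto simp: p push_zero)
  next
    case (Cons q u)
    obtain h s where q: "q = (h, s)" by fastforce
    have *: "reduced (foldr push u w)" using assms(2) by (rule reduced_foldr)
    show ?thesis
      using push_push_same[OF *, of g r s] by (auto simp: p q Cons push_zero)
  qed
qed

lemma foldr_push_assoc:
  assumes "reduced v" "reduced w"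
  shows "foldr push (foldr push u v) w = foldr push u (foldr push v w)"
  using assms by (induction u) (auto simp: foldr_push_push reduced_foldr)

lemma foldr_push_Nil: "reduced w \<Longrightarrow> foldr push w [] = w"
proof (induction w)
  case (Cons p w)
  then have "foldr push w [] = w" by (auto simp: reduced_def distinct_adj_Cons)
  with Cons.prems show ?case
    by (cases p; cases w) (auto simp: reduced_def)
qed simp

lemma foldr_push_inverse:
  "foldr push (rev (map (\<lambda>(g, r). (g, - r)) w)) (foldr push w v) = v" if "reduced v"
proof (induction w)
  case (Cons p w)
  obtain g r where "p = (g, r)" by fastforce
  with Cons show ?case
    using push_push_same[OF reduced_foldr[OF that], of g "- r" r w] by (simp add: push_zero)
qed simp

lemma fst_foldr_push: "fst ` set (foldr push v w) \<subseteq> fst ` set v \<union> fst ` set w"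
proof (induction v)
  case (Cons p v)
  then show ?case using fst_push[of p "foldr push v w"] by simp blast
qed simp

lemma reduced_inverse: "reduced w \<Longrightarrow> reduced (rev (map (\<lambda>(g, r). (g, - r)) w))"
  by (auto simp: reduced_def rev_map[symmetric] case_prod_unfold o_def)

lemma group_FR: "group (FR G)"
proof (rule groupI)
  fix x y z assume "x \<in> carrier (FR G)" "y \<in> carrier (FR G)"
  then show "x \<otimes>\<^bsub>FR G\<^esub> y \<in> carrier (FR G)"
    using fst_foldr_push[of x y] by (simp add: FR_def reduced_foldr) blast
next
  fix x y z assume "x \<in> carrier (FR G)" "y \<in> carrier (FR G)" "z \<in> carrier (FR G)"
  then show "x \<otimes>\<^bsub>FR G\<^esub> y \<otimes>\<^bsub>FR G\<^esub> z = x \<otimes>\<^bsub>FR G\<^esub> (y \<otimes>\<^bsub>FR G\<^esub> z)"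
    by (simp add: FR_def foldr_push_assoc)
next
  fix x assume x: "x \<in> carrier (FR G)"
  let ?y = "rev (map (\<lambda>(g, r). (g, - r)) x)"
  have "?y \<in> carrier (FR G)"
    using x reduced_inverse[of x] by (force simp: FR_def)
  moreover have "?y \<otimes>\<^bsub>FR G\<^esub> x = \<one>\<^bsub>FR G\<^esub>"
    using x foldr_push_inverse[of "[]" x] by (simp add: FR_def foldr_push_Nil reduced_def)
  ultimately show "\<exists>y\<in>carrier (FR G). y \<otimes>\<^bsub>FR G\<^esub> x = \<one>\<^bsub>FR G\<^esub>" by blast
qed (auto simp: FR_def reduced_def)

lemma syl_closed: "g \<in> carrier G \<Longrightarrow> syl g r \<in> carrier (FR G)"
  by (auto simp: syl_def FR_def reduced_def)

lemma syl_add: "syl g (r + s) = syl g r \<otimes>\<^bsub>FR G\<^esub> syl g s"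
  by (auto simp: syl_def FR_def)

lemma syl_zero [simp]: "syl g 0 = []"
  by (simp add: syl_def)

lemma inv_syl:
  assumes "g \<in> carrier G" shows "inv\<^bsub>FR G\<^esub> syl g r = syl g (- r)"
proof -
  have "syl g (- r) \<otimes>\<^bsub>FR G\<^esub> syl g r = \<one>\<^bsub>FR G\<^esub>"
    using syl_add[of g "- r" r G] by (simp add: FR_def)
  then show ?thesis
    using assms by (intro group.inv_equality[OF group_FR]) (auto intro: syl_closed)
qed

text \<open>Extension of homomorphisms, where the exponents may be confined to a subset \<open>A\<close> of the
  reals (all of them for \<open>\<psi>\<close>, the integers for \<open>\<pi>\<^sub>F\<close>).\<close>

locale syllable_map =
  fixes G :: "('a, 'm) monoid_scheme" and M :: "('c, 'n) monoid_scheme"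
    and A :: "real set" and f :: "'a \<Rightarrow> real \<Rightarrow> 'c"
  assumes group_M: "group M"
    and closed: "\<And>g r. g \<in> carrier G \<Longrightarrow> r \<in> A \<Longrightarrow> f g r \<in> carrier M"
    and add: "\<And>g r s. g \<in> carrier G \<Longrightarrow> r \<in> A \<Longrightarrow> s \<in> A \<Longrightarrow> f g (r + s) = f g r \<otimes>\<^bsub>M\<^esub> f g s"
    and zero: "\<And>g. g \<in> carrier G \<Longrightarrow> f g 0 = \<one>\<^bsub>M\<^esub>"
begin

lemma eval_closed: "set w \<subseteq> carrier G \<times> A \<Longrightarrow> word_eval M f w \<in> carrier M"
proof (induction w)
  case Nil
  then show ?case using group_M by (simp add: word_eval_def group.is_monoid)
next
  case (Cons p w)
  then show ?case
    using closed group_M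
    by (cases p) (auto simp: word_eval_def group.is_monoid intro!: monoid.m_closed)
qed

lemma eval_push:
  assumes "g \<in> carrier G" "r \<in> A" "set w \<subseteq> carrier G \<times> A"
  shows "word_eval M f (push (g, r) w) = f g r \<otimes>\<^bsub>M\<^esub> word_eval M f w"
proof -
  interpret M: group M by (rule group_M)
  show ?thesis
  proof (cases w)
    case Nil
    then show ?thesis using assms zero by (auto simp: word_eval_def)
  next
    case (Cons p v)
    obtain h s where p: "p = (h, s)" by fastforce
    have h: "h \<in> carrier G" "s \<in> A" "set v \<subseteq> carrier G \<times> A"
      using assms(3) by (auto simp: Cons p)
    have v: "word_eval M f v \<in> carrier M" using h by (intro eval_closed)
    have c: "word_eval M f ((k, t) # u) = f k t \<otimes>\<^bsub>M\<^esub> word_eval M f u" for k t u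
      by (simp add: word_eval_def)
    have *: "f g r \<otimes>\<^bsub>M\<^esub> (f g s \<otimes>\<^bsub>M\<^esub> word_eval M f v) = f g (r + s) \<otimes>\<^bsub>M\<^esub> word_eval M f v"
      using assms h v closed by (simp add: add M.m_assoc)
    show ?thesis
      unfolding Cons p using assms h v * zero closed by (auto simp: c)
  qed
qed

lemma eval_mult:
  assumes "set v \<subseteq> carrier G \<times> A" "set w \<subseteq> carrier G \<times> A"
    and A: "\<And>r s. r \<in> A \<Longrightarrow> s \<in> A \<Longrightarrow> r + s \<in> A"
  shows "set (foldr push v w) \<subseteq> carrier G \<times> A \<and>
    word_eval M f (foldr push v w) = word_eval M f v \<otimes>\<^bsub>M\<^esub> word_eval M f w"
  using assms(1)
proof (induction v)
  case Nil
  then show ?case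
    using group_M eval_closed[OF assms(2)] assms(2)
    by (simp add: word_eval_def group.is_monoid monoid.l_one)
next
  case (Cons p v)
  interpret M: group M by (rule group_M)
  obtain g r where p: "p = (g, r)" by fastforce
  have g: "g \<in> carrier G" "r \<in> A" "set v \<subseteq> carrier G \<times> A" using Cons.prems p by auto
  have IH: "set (foldr push v w) \<subseteq> carrier G \<times> A"
    "word_eval M f (foldr push v w) = word_eval M f v \<otimes>\<^bsub>M\<^esub> word_eval M f w"
    using Cons.IH g by auto
  have "set (push (g, r) u) \<subseteq> carrier G \<times> A" if "set u \<subseteq> carrier G \<times> A" for u
    using that g A by (cases "((g, r), u)" rule: push.cases) auto
  moreover have "word_eval M f (p # v) = f g r \<otimes>\<^bsub>M\<^esub> word_eval M f v"
    by (simp add: p word_eval_def)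
  ultimately show ?case
    using eval_push[OF g(1,2) IH(1)] IH g closed eval_closed[OF g(3)] eval_closed[OF assms(2)]
    by (simp add: p M.m_assoc)
qed

end

text \<open>The universal property of the free product.\<close>

lemma word_eval_hom:
  assumes "syllable_map G M UNIV f"
  shows "word_eval M f \<in> hom (FR G) M"
    and "g \<in> carrier G \<Longrightarrow> word_eval M f (syl g r) = f g r"
proof -
  interpret syllable_map G M UNIV f by fact
  have sub: "set w \<subseteq> carrier G \<times> UNIV" if "w \<in> carrier (FR G)" for w
    using that by (force simp: FR_def)
  show "word_eval M f \<in> hom (FR G) M"
    using eval_closed[OF sub] eval_mult[OF sub sub] by (intro homI) (auto simp: FR_def)
  show "word_eval M f (syl g r) = f g r" if "g \<in> carrier G"
    using that eval_push[of g r "[]"] closed[of g r] group_M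
    by (simp add: syl_def word_eval_def group.is_monoid)
qed

lemma \<psi>_hom:
  shows "\<psi> G t \<in> hom (FR G) (FR G)"
    and "g \<in> carrier G \<Longrightarrow> \<psi> G t (syl g r) = syl g (t * r)"
proof -
  have *: "syllable_map G (FR G) UNIV (\<lambda>g r. syl g (t * r))"
    by (rule syllable_map.intro)
       (simp_all add: group_FR syl_closed distrib_left syl_add[of _ _ _ G], simp add: FR_def)
  show "\<psi> G t \<in> hom (FR G) (FR G)" "g \<in> carrier G \<Longrightarrow> \<psi> G t (syl g r) = syl g (t * r)"
    using word_eval_hom[OF *] by (auto simp: \<psi>_def)
qed

lemma F_integral: "w \<in> carrier (F_grp G) \<Longrightarrow> set w \<subseteq> carrier G \<times> \<int>"
proof -
  interpret FR: group "FR G" by (rule group_FR)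
  have push: "set (push (g, r) u) \<subseteq> carrier G \<times> \<int>"
    if "set u \<subseteq> carrier G \<times> \<int>" "g \<in> carrier G" "r \<in> \<int>" for u :: "'a word" and g r
    using that by (cases "((g, r), u)" rule: push.cases) auto
  have fold: "set (foldr push v u) \<subseteq> carrier G \<times> \<int>"
    if "set v \<subseteq> carrier G \<times> \<int>" "set u \<subseteq> carrier G \<times> \<int>" for u v :: "'a word"
    using that
  proof (induction v)
    case (Cons p v)
    then show ?case using push[of "foldr push v u" "fst p" "snd p"] by auto
  qed simp
  assume "w \<in> carrier (F_grp G)"
  then have "w \<in> generate (FR G) {syl g 1 | g. g \<in> carrier G}" by (simp add: F_grp_def)
  then show ?thesis
  proof induction
    case (eng v u)
    then show ?case using fold[of v u] by (simp add: FR_def)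
  qed (auto simp: inv_syl, auto simp: syl_def FR_def)
qed

lemma \<pi>\<^sub>F_hom:
  assumes "group G"
  shows "\<pi>\<^sub>F G \<in> hom (F_grp G) G" and "g \<in> carrier G \<Longrightarrow> \<pi>\<^sub>F G (syl g 1) = g"
proof -
  interpret group G by fact
  interpret syllable_map G G "\<int>" "\<lambda>g r. g [^]\<^bsub>G\<^esub> \<lfloor>r\<rfloor>"
    by unfold_locales (auto simp: int_pow_mult elim!: Ints_cases)
  show "\<pi>\<^sub>F G \<in> hom (F_grp G) G"
    using eval_closed[OF F_integral] eval_mult[OF F_integral F_integral]
    by (intro homI) (auto simp: \<pi>\<^sub>F_def F_grp_def FR_def)
  show "\<pi>\<^sub>F G (syl g 1) = g" if "g \<in> carrier G"
    using that by (simp add: \<pi>\<^sub>F_def word_eval_def syl_def)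
qed


section \<open>The directional asymptotic cone\<close>

definition scaling_set :: "real set \<Rightarrow> bool" where
  "scaling_set T \<longleftrightarrow> T \<subseteq> {0<..} \<and> \<not> bdd_above T"

definition cauchy_along ::
  "('a, 'm) monoid_scheme \<Rightarrow> ('a \<Rightarrow> real) \<Rightarrow> real set \<Rightarrow> (real \<Rightarrow> 'a) \<Rightarrow> bool" where
  "cauchy_along G \<nu> T f \<longleftrightarrow>
     (\<forall>\<epsilon>>0. \<exists>M. \<forall>t\<in>T. \<forall>t'\<in>T. t \<ge> M \<longrightarrow> t' \<ge> M \<longrightarrow> norm_dist G \<nu> (f t) (f t') < \<epsilon>)"

text \<open>Functions on \<open>T\<close> are extensional, and \<open>product_group\<close> carries the pointwise product.\<close>

definition DD :: "('a, 'm) monoid_scheme \<Rightarrow> ('a \<Rightarrow> real) \<Rightarrow> real set \<Rightarrow> (real \<Rightarrow> 'a word) monoid" where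
  "DD G \<nu> T = (product_group T (\<lambda>_. F_grp G))
     \<lparr>carrier := {w \<in> T \<rightarrow>\<^sub>E carrier (F_grp G). cauchy_along (FR G) (FR_norm G \<nu>) T (\<lambda>t. \<psi> G (1 / t) (w t))}\<rparr>"

definition DD_norm :: "('a, 'm) monoid_scheme \<Rightarrow> ('a \<Rightarrow> real) \<Rightarrow> real set \<Rightarrow> (real \<Rightarrow> 'a word) \<Rightarrow> real" where
  "DD_norm G \<nu> T w = Lim (inf at_top (principal T)) (\<lambda>t. FR_norm G \<nu> (\<psi> G (1 / t) (w t)))"

definition CC :: "('a, 'm) monoid_scheme \<Rightarrow> ('a \<Rightarrow> real) \<Rightarrow> real set \<Rightarrow> (real \<Rightarrow> 'a) monoid" where
  "CC G \<nu> T = (product_group T (\<lambda>_. G))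
     \<lparr>carrier := {\<lambda>t\<in>T. \<pi>\<^sub>F G (w t) | w. w \<in> carrier (DD G \<nu> T)}\<rparr>"

definition CC_norm :: "('a, 'm) monoid_scheme \<Rightarrow> ('a \<Rightarrow> real) \<Rightarrow> real set \<Rightarrow> (real \<Rightarrow> 'a) \<Rightarrow> real" where
  "CC_norm G \<nu> T g =
     Inf {DD_norm G \<nu> T w | w. w \<in> carrier (DD G \<nu> T) \<and> (\<lambda>t\<in>T. \<pi>\<^sub>F G (w t)) = g}"

definition null_subgroup :: "('a, 'm) monoid_scheme \<Rightarrow> ('a \<Rightarrow> real) \<Rightarrow> real set \<Rightarrow> (real \<Rightarrow> 'a) set" where
  "null_subgroup G \<nu> T = {g \<in> carrier (CC G \<nu> T). CC_norm G \<nu> T g = 0}"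

definition dir_cone :: "('a, 'm) monoid_scheme \<Rightarrow> ('a \<Rightarrow> real) \<Rightarrow> real set \<Rightarrow> (real \<Rightarrow> 'a) set monoid" where
  "dir_cone G \<nu> T = CC G \<nu> T Mod null_subgroup G \<nu> T"

definition cone_class ::
  "('a, 'm) monoid_scheme \<Rightarrow> ('a \<Rightarrow> real) \<Rightarrow> real set \<Rightarrow> (real \<Rightarrow> 'a) \<Rightarrow> (real \<Rightarrow> 'a) set" where
  "cone_class G \<nu> T g = null_subgroup G \<nu> T #>\<^bsub>CC G \<nu> T\<^esub> g"

text \<open>The norm on the cone and the induced maps are given by the common value on all
  representatives of a class.\<close>

definition cone_norm :: "('a, 'm) monoid_scheme \<Rightarrow> ('a \<Rightarrow> real) \<Rightarrow> real set \<Rightarrow> (real \<Rightarrow> 'a) set \<Rightarrow> real" where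
  "cone_norm G \<nu> T x = the_elem (CC_norm G \<nu> T ` x)"

definition cone_map ::
  "('b, 'n) monoid_scheme \<Rightarrow> ('b \<Rightarrow> real) \<Rightarrow> real set \<Rightarrow> ('a \<Rightarrow> 'b) \<Rightarrow> (real \<Rightarrow> 'a) set \<Rightarrow> (real \<Rightarrow> 'b) set"
  where "cone_map H \<mu> T \<phi> x = the_elem ((\<lambda>g. cone_class H \<mu> T (\<lambda>t\<in>T. \<phi> (g t))) ` x)"

end

theory Submission
  imports Defs
begin

text \<open>
  The norm on the free product \<^term>\<open>FR G\<close> depends on \<open>G\<close> only through the norms of the labels, so
  every map of sets \<open>f\<close> from \<open>G\<close> to \<open>H\<close> with \<open>\<mu> (f g) \<le> C * \<nu> g\<close> and \<open>C > 0\<close>, multiplicative or not, induces a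
  homomorphism of free products with Lipschitz constant \<open>C\<close>.  It commutes with the rescalings \<open>\<psi>\<close>,
  and therefore turns elements of \<^const>\<open>DD\<close> over \<open>G\<close> into elements of \<^const>\<open>DD\<close> over \<open>H\<close>,
  with the same constant (\<open>relabel_DD\<close>).  This is used in both directions.

  For \<open>f = \<pi>\<close>, with \<open>C = 1\<close>, it shows that \<open>g \<mapsto> \<pi> \<circ> g\<close> maps \<^const>\<open>CC\<close> over \<open>G\<close> to \<^const>\<open>CC\<close> over \<open>H\<close>
  without increasing norms (\<open>cone_fun_nonexpanding\<close>).  In the other direction, \<open>\<pi>\<close> is a metric quotient,
  so it has set-theoretic sections \<open>s\<close> with \<open>\<nu> (s h) \<le> (1 + \<epsilon>) * \<mu> h\<close>.  Relabelling by \<open>s\<close> lifts every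
  element of \<^const>\<open>CC\<close> over \<open>H\<close> to one over \<open>G\<close> with almost the same norm (\<open>cone_fun_lift\<close>).

  Two elements of \<^const>\<open>CC\<close> over \<open>G\<close> with the same image under \<open>\<pi>\<close> differ by a function \<open>k\<close> with values
  in the kernel, hence with \<open>\<nu> (k t) \<le> K\<close>.  The one-letter words labelled by \<open>k t\<close> represent \<open>k\<close>, and
  their rescaled norms, at most \<open>K / t\<close>, tend to zero; so \<open>k\<close> has norm zero (\<open>CC_norm_bounded\<close>).
  Together, \<open>g \<mapsto> \<pi> \<circ> g\<close> is surjective and preserves pseudonorms (\<open>CC_norm_cone_fun\<close>), and such a
  homomorphism becomes a bijective isometry once the elements of norm zero are divided out
  (\<open>norm_preserving_epi_isometry\<close>).
\<close>

section \<open>Pseudonormed groups\<close>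

locale pseudonormed_group = group G for G (structure) +
  fixes \<nu> :: "'a \<Rightarrow> real"
  assumes norm_nonneg: "x \<in> carrier G \<Longrightarrow> 0 \<le> \<nu> x"
    and norm_one: "\<nu> \<one> = 0"
    and norm_inv: "x \<in> carrier G \<Longrightarrow> \<nu> (inv x) = \<nu> x"
    and norm_mult: "x \<in> carrier G \<Longrightarrow> y \<in> carrier G \<Longrightarrow> \<nu> (x \<otimes> y) \<le> \<nu> x + \<nu> y"
    and norm_conj: "x \<in> carrier G \<Longrightarrow> h \<in> carrier G \<Longrightarrow> \<nu> (h \<otimes> x \<otimes> inv h) = \<nu> x"

lemma conj_inv_norm_pseudonormed:
  assumes "group G" "conj_inv_norm G \<nu>"
  shows "pseudonormed_group G \<nu>"
proof -
  interpret group G by fact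
  show ?thesis
    using assms(2) by unfold_locales (auto simp: conj_inv_norm_def)
qed

context group
begin

lemma inv_mult_cancel [simp]: "x \<in> carrier G \<Longrightarrow> y \<in> carrier G \<Longrightarrow> inv x \<otimes> (x \<otimes> y) = y"
  by (simp add: m_assoc [symmetric])

lemma mult_inv_cancel [simp]: "x \<in> carrier G \<Longrightarrow> y \<in> carrier G \<Longrightarrow> x \<otimes> (inv x \<otimes> y) = y"
  by (simp add: m_assoc [symmetric])

text \<open>Both \<^const>\<open>FR_norm\<close> and \<^const>\<open>CC_norm\<close> are infima of the costs of the ways to produce an
  element: a factorisation into conjugates of syllables, or a preimage.  Such an infimum is a
  pseudonorm because the ways to produce two elements can be multiplied, inverted and conjugated.\<close>

lemma pseudonormed_group_Inf:
  assumes ex: "\<And>x. x \<in> carrier G \<Longrightarrow> \<exists>c. R x c"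
    and nonneg: "\<And>x c. R x c \<Longrightarrow> (0::real) \<le> c"
    and one: "R \<one> 0"
    and mult: "\<And>x y c d. x \<in> carrier G \<Longrightarrow> y \<in> carrier G \<Longrightarrow> R x c \<Longrightarrow> R y d \<Longrightarrow> \<exists>e\<le>c + d. R (x \<otimes> y) e"
    and inv: "\<And>x c. x \<in> carrier G \<Longrightarrow> R x c \<Longrightarrow> R (inv x) c"
    and conj: "\<And>x h c. x \<in> carrier G \<Longrightarrow> h \<in> carrier G \<Longrightarrow> R x c \<Longrightarrow> R (h \<otimes> x \<otimes> inv h) c"
  shows "pseudonormed_group G (\<lambda>x. Inf {c. R x c})"
proof unfold_locales
  have bdd: "bdd_below {c. R x c}" for x
    using nonneg by (intro bdd_belowI[of _ 0]) auto
  have lower: "Inf {c. R x c} \<le> c" if "R x c" for x c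
    using that bdd by (intro cInf_lower) auto
  show nn: "0 \<le> Inf {c. R x c}" if "x \<in> carrier G" for x
    using ex[OF that] nonneg by (intro cInf_greatest) auto
  show "Inf {c. R \<one> c} = 0"
    using lower[OF one] nn[OF one_closed] by simp
  show "Inf {c. R (inv x) c} = Inf {c. R x c}" if "x \<in> carrier G" for x
  proof -
    have "{c. R (inv x) c} = {c. R x c}"
      using inv[of x] inv[of "inv x"] that by auto
    then show ?thesis by simp
  qed
  show "Inf {c. R (h \<otimes> x \<otimes> inv h) c} = Inf {c. R x c}"
    if x: "x \<in> carrier G" and h: "h \<in> carrier G" for x h
  proof -
    have "inv h \<otimes> (h \<otimes> x \<otimes> inv h) \<otimes> inv (inv h) = x"
      using x h by (simp add: m_assoc)
    then have "{c. R (h \<otimes> x \<otimes> inv h) c} = {c. R x c}"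
      using conj[of x h] conj[of "h \<otimes> x \<otimes> inv h" "inv h"] x h by auto
    then show ?thesis by simp
  qed
  show "Inf {c. R (x \<otimes> y) c} \<le> Inf {c. R x c} + Inf {c. R y c}"
    if x: "x \<in> carrier G" and y: "y \<in> carrier G" for x y
  proof -
    have "Inf {c. R (x \<otimes> y) c} - d \<le> Inf {c. R x c}" if d: "R y d" for d
    proof (rule cInf_greatest)
      fix c assume "c \<in> {c. R x c}"
      then obtain e where "e \<le> c + d" "R (x \<otimes> y) e" using mult[OF x y _ d] by auto
      then show "Inf {c. R (x \<otimes> y) c} - d \<le> c" using lower[of "x \<otimes> y" e] by simp
    qed (use ex[OF x] in auto)
    then have "Inf {c. R (x \<otimes> y) c} - Inf {c. R x c} \<le> Inf {c. R y c}"
      using ex[OF y] by (intro cInf_greatest) (auto simp: algebra_simps)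
    then show ?thesis by simp
  qed
qed

end

context pseudonormed_group
begin

lemma norm_diff_le:
  assumes "x \<in> carrier G" "y \<in> carrier G"
  shows "\<bar>\<nu> x - \<nu> y\<bar> \<le> norm_dist G \<nu> x y"
proof -
  have "\<nu> y \<le> \<nu> x + \<nu> (inv x \<otimes> y)"
    using norm_mult[of x "inv x \<otimes> y"] assms by simp
  moreover have "\<nu> x \<le> \<nu> y + \<nu> (inv (inv x \<otimes> y))"
    using norm_mult[of y "inv (inv x \<otimes> y)"] assms by (simp add: inv_mult_group)
  ultimately show ?thesis
    using assms norm_inv[of "inv x \<otimes> y"] unfolding norm_dist_def by simp
qed

lemma norm_conj':
  assumes "x \<in> carrier G" "h \<in> carrier G"
  shows "\<nu> (inv h \<otimes> x \<otimes> h) = \<nu> x"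
  using norm_conj[of x "inv h"] assms by simp

lemma norm_dist_mult:
  assumes "x \<in> carrier G" "y \<in> carrier G" "x' \<in> carrier G" "y' \<in> carrier G"
  shows "norm_dist G \<nu> (x \<otimes> y) (x' \<otimes> y') \<le> norm_dist G \<nu> x x' + norm_dist G \<nu> y y'"
proof -
  have "inv (x \<otimes> y) \<otimes> (x' \<otimes> y') = (inv y \<otimes> (inv x \<otimes> x') \<otimes> y) \<otimes> (inv y \<otimes> y')"
    using assms by (simp add: m_assoc inv_mult_group)
  then show ?thesis
    using norm_mult[of "inv y \<otimes> (inv x \<otimes> x') \<otimes> y" "inv y \<otimes> y'"] norm_conj'[of "inv x \<otimes> x'" y] assms
    by (simp add: norm_dist_def)
qed

lemma norm_dist_inv:
  assumes "x \<in> carrier G" "y \<in> carrier G"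
  shows "norm_dist G \<nu> (inv x) (inv y) = norm_dist G \<nu> x y"
proof -
  have "x \<otimes> inv y = x \<otimes> inv (inv x \<otimes> y) \<otimes> inv x"
    using assms by (simp add: m_assoc inv_mult_group)
  then show ?thesis
    using norm_conj[of "inv (inv x \<otimes> y)" x] norm_inv[of "inv x \<otimes> y"] assms
    by (simp add: norm_dist_def)
qed

lemma norm_dist_le:
  assumes "x \<in> carrier G" "y \<in> carrier G"
  shows "norm_dist G \<nu> x y \<le> \<nu> x + \<nu> y"
  using norm_mult[of "inv x" y] norm_inv[of x] assms by (simp add: norm_dist_def)

lemma cauchy_along_mult:
  assumes "f \<in> T \<rightarrow> carrier G" "f' \<in> T \<rightarrow> carrier G"
    and "cauchy_along G \<nu> T f" "cauchy_along G \<nu> T f'"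
  shows "cauchy_along G \<nu> T (\<lambda>t. f t \<otimes> f' t)"
  unfolding cauchy_along_def
proof (intro allI impI)
  fix e :: real assume "e > 0"
  then have "e / 2 > 0" by simp
  obtain M where M: "\<And>t t'. t \<in> T \<Longrightarrow> t' \<in> T \<Longrightarrow> t \<ge> M \<Longrightarrow> t' \<ge> M \<Longrightarrow> norm_dist G \<nu> (f t) (f t') < e / 2"
    using assms(3) \<open>e / 2 > 0\<close> unfolding cauchy_along_def by blast
  obtain M' where M': "\<And>t t'. t \<in> T \<Longrightarrow> t' \<in> T \<Longrightarrow> t \<ge> M' \<Longrightarrow> t' \<ge> M' \<Longrightarrow> norm_dist G \<nu> (f' t) (f' t') < e / 2"
    using assms(4) \<open>e / 2 > 0\<close> unfolding cauchy_along_def by blast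
  have "norm_dist G \<nu> (f t \<otimes> f' t) (f t' \<otimes> f' t') < e"
    if t: "t \<in> T" "t' \<in> T" "t \<ge> max M M'" "t' \<ge> max M M'" for t t'
    using norm_dist_mult[of "f t" "f' t" "f t'" "f' t'"] M[OF t(1,2)] M'[OF t(1,2)] t assms(1,2)
    by (auto simp: Pi_iff)
  then show "\<exists>M. \<forall>t\<in>T. \<forall>t'\<in>T. t \<ge> M \<longrightarrow> t' \<ge> M \<longrightarrow> norm_dist G \<nu> (f t \<otimes> f' t) (f t' \<otimes> f' t') < e"
    by blast
qed

lemma cauchy_along_inv:
  assumes "f \<in> T \<rightarrow> carrier G" "cauchy_along G \<nu> T f"
  shows "cauchy_along G \<nu> T (\<lambda>t. inv (f t))"
proof -
  have "norm_dist G \<nu> (inv (f t)) (inv (f t')) = norm_dist G \<nu> (f t) (f t')" if "t \<in> T" "t' \<in> T" for t t'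
    using that assms(1) by (intro norm_dist_inv) auto
  then show ?thesis using assms(2) by (simp add: cauchy_along_def)
qed

text \<open>This is what makes the limit in the definition of \<^const>\<open>DD_norm\<close> exist: the norm is
  1-Lipschitz, so it sends Cauchy functions to real Cauchy functions.\<close>

lemma cauchy_along_norm_convergent:
  assumes f: "f \<in> T \<rightarrow> carrier G" and cauchy: "cauchy_along G \<nu> T f"
    and bot: "inf at_top (principal T) \<noteq> bot"
  obtains l where "((\<lambda>t. \<nu> (f t)) \<longlongrightarrow> l) (inf at_top (principal T))"
proof -
  let ?F = "inf at_top (principal T)"
  have "cauchy_filter (filtermap (\<lambda>t. \<nu> (f t)) ?F)"
    unfolding cauchy_filter_metric_filtermap
  proof (intro allI impI)
    fix e :: real assume "e > 0"
    then obtain M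
      where M: "\<And>t t'. t \<in> T \<Longrightarrow> t' \<in> T \<Longrightarrow> t \<ge> M \<Longrightarrow> t' \<ge> M \<Longrightarrow> norm_dist G \<nu> (f t) (f t') < e"
      using cauchy unfolding cauchy_along_def by blast
    have "eventually (\<lambda>t. t \<in> T \<and> t \<ge> M) ?F"
      unfolding eventually_inf_principal using eventually_ge_at_top[of M] by eventually_elim simp
    moreover have "dist (\<nu> (f t)) (\<nu> (f t')) < e" if "t \<in> T \<and> t \<ge> M" "t' \<in> T \<and> t' \<ge> M" for t t'
      using norm_diff_le[of "f t" "f t'"] M[of t t'] that f by (force simp: dist_real_def)
    ultimately show "\<exists>P. eventually P ?F \<and> (\<forall>t t'. P t \<and> P t' \<longrightarrow> dist (\<nu> (f t)) (\<nu> (f t')) < e)"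
      by blast
  qed
  moreover have "complete (UNIV :: real set)"
    by (meson Cauchy_convergent UNIV_I complete_def convergent_def)
  ultimately obtain l where "filtermap (\<lambda>t. \<nu> (f t)) ?F \<le> nhds l"
    using bot unfolding complete_uniform by (force simp: filtermap_bot_iff)
  then show ?thesis by (intro that[of l]) (simp add: filterlim_def)
qed

lemma cauchy_along_of_norm_tendsto_0:
  assumes f: "f \<in> T \<rightarrow> carrier G" and lim: "((\<lambda>t. \<nu> (f t)) \<longlongrightarrow> 0) (inf at_top (principal T))"
  shows "cauchy_along G \<nu> T f"
  unfolding cauchy_along_def
proof (intro allI impI)
  fix e :: real assume "e > 0"
  then have "eventually (\<lambda>t. \<nu> (f t) < e / 2) (inf at_top (principal T))"
    using order_tendstoD(2)[OF lim, of "e / 2"] by simp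
  then obtain M where M: "\<And>t. t \<in> T \<Longrightarrow> t \<ge> M \<Longrightarrow> \<nu> (f t) < e / 2"
    by (auto simp: eventually_inf_principal eventually_at_top_linorder)
  have "norm_dist G \<nu> (f t) (f t') < e" if "t \<in> T" "t' \<in> T" "t \<ge> M" "t' \<ge> M" for t t'
    using norm_dist_le[of "f t" "f t'"] M[of t] M[of t'] that f by (auto simp: Pi_iff)
  then show "\<exists>M. \<forall>t\<in>T. \<forall>t'\<in>T. t \<ge> M \<longrightarrow> t' \<ge> M \<longrightarrow> norm_dist G \<nu> (f t) (f t') < e" by blast
qed

subsection \<open>The quotient by the elements of norm zero\<close>

definition null_elements :: "'a set" where
  "null_elements = {x \<in> carrier G. \<nu> x = 0}"

lemma norm_mult_null:
  assumes "x \<in> carrier G" "y \<in> carrier G" "\<nu> x = 0"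
  shows "\<nu> (x \<otimes> y) = \<nu> y"
proof -
  have "\<nu> y \<le> \<nu> (inv x) + \<nu> (x \<otimes> y)"
    using norm_mult[of "inv x" "x \<otimes> y"] assms by simp
  then show ?thesis
    using norm_mult[of x y] norm_inv[of x] assms by simp
qed

lemma null_elements_normal: "null_elements \<lhd> G"
proof (rule normal_invI)
  show "subgroup null_elements G"
    by (rule subgroupI)
       (use norm_one norm_mult_null norm_inv in \<open>auto simp: null_elements_def\<close>)
qed (auto simp: null_elements_def norm_conj)

lemma norm_on_coset:
  assumes "x \<in> carrier G"
  shows "\<nu> ` (null_elements #> x) = {\<nu> x}"
proof -
  have "\<nu> y = \<nu> x" if "y \<in> null_elements #> x" for y
    using that assms norm_mult_null by (auto simp: r_coset_def null_elements_def)
  moreover have "x \<in> null_elements #> x"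
    using assms null_elements_normal by (intro rcos_self normal_imp_subgroup)
  ultimately show ?thesis by blast
qed

lemma null_coset_eq_iff:
  assumes "x \<in> carrier G" "y \<in> carrier G"
  shows "null_elements #> x = null_elements #> y \<longleftrightarrow> \<nu> (x \<otimes> inv y) = 0"
proof -
  interpret N: normal null_elements G by (rule null_elements_normal)
  have "null_elements #> x = null_elements #> y \<longleftrightarrow> x \<in> null_elements #> y"
    using rcos_self[OF assms(1) N.subgroup_axioms] repr_independence[OF _ assms(2) N.subgroup_axioms, of x] by auto
  also have "\<dots> \<longleftrightarrow> x \<otimes> inv y \<in> null_elements"
    by (rule N.rcos_module[OF is_group assms(2,1)])
  also have "\<dots> \<longleftrightarrow> \<nu> (x \<otimes> inv y) = 0"
    unfolding null_elements_def using assms by simp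
  finally show ?thesis .
qed

lemma norm_dist_quotient:
  assumes "x \<in> carrier G" "y \<in> carrier G"
  shows "norm_dist (G Mod null_elements) (\<lambda>C. the_elem (\<nu> ` C))
    (null_elements #> x) (null_elements #> y) = norm_dist G \<nu> x y"
proof -
  interpret N: normal null_elements G by (rule null_elements_normal)
  have "inv\<^bsub>G Mod null_elements\<^esub> (null_elements #> x) = null_elements #> inv x"
    using assms by (simp add: N.inv_FactGroup carrier_FactGroup N.rcos_inv)
  then show ?thesis
    using assms by (simp add: norm_dist_def N.rcos_sum norm_on_coset)
qed

end

text \<open>An epimorphism that preserves pseudonorms has a kernel of norm zero, so it becomes injective
  once the elements of norm zero are divided out.\<close>

lemma norm_preserving_epi_isometry:
  fixes f :: "'a \<Rightarrow> 'b" and G :: "('a, 'm) monoid_scheme" and H :: "('b, 'n) monoid_scheme"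
    and \<nu> :: "'a \<Rightarrow> real" and \<mu> :: "'b \<Rightarrow> real"
  defines "cls \<equiv> \<lambda>x. pseudonormed_group.null_elements H \<mu> #>\<^bsub>H\<^esub> f x"
  assumes G: "pseudonormed_group G \<nu>" and H: "pseudonormed_group H \<mu>"
    and epi: "f \<in> epi G H" and pres: "\<And>x. x \<in> carrier G \<Longrightarrow> \<mu> (f x) = \<nu> x"
  shows "x \<in> carrier G \<Longrightarrow> the_elem (cls ` (pseudonormed_group.null_elements G \<nu> #>\<^bsub>G\<^esub> x)) = cls x"
    and "isometry (G Mod pseudonormed_group.null_elements G \<nu>) (\<lambda>C. the_elem (\<nu> ` C))
      (H Mod pseudonormed_group.null_elements H \<mu>) (\<lambda>C. the_elem (\<mu> ` C)) (\<lambda>C. the_elem (cls ` C))"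
proof -
  interpret G: pseudonormed_group G \<nu> by fact
  interpret H: pseudonormed_group H \<mu> by fact
  interpret f: group_hom G H f using epi by unfold_locales (simp add: epi_def)
  interpret N: normal G.null_elements G by (rule G.null_elements_normal)
  have cls_eq: "cls x = cls y \<longleftrightarrow> G.null_elements #>\<^bsub>G\<^esub> x = G.null_elements #>\<^bsub>G\<^esub> y"
    if "x \<in> carrier G" "y \<in> carrier G" for x y
  proof -
    have "\<mu> (f x \<otimes>\<^bsub>H\<^esub> inv\<^bsub>H\<^esub> f y) = \<nu> (x \<otimes>\<^bsub>G\<^esub> inv\<^bsub>G\<^esub> y)"
      using pres[of "x \<otimes>\<^bsub>G\<^esub> inv\<^bsub>G\<^esub> y"] that by simp
    then show ?thesis
      unfolding cls_def using that by (simp add: G.null_coset_eq_iff H.null_coset_eq_iff)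
  qed
  show the: "the_elem (cls ` (G.null_elements #>\<^bsub>G\<^esub> x)) = cls x" if x: "x \<in> carrier G" for x
  proof -
    have "cls y = cls x" if "y \<in> G.null_elements #>\<^bsub>G\<^esub> x" for y
    proof -
      have "y \<in> carrier G"
        using that x N.subset by (auto simp: r_coset_def)
      then show ?thesis
        using cls_eq[OF x, of y] G.repr_independence[OF that x N.subgroup_axioms] by simp
    qed
    then have "cls ` (G.null_elements #>\<^bsub>G\<^esub> x) = {cls x}"
      using G.rcos_self[OF x N.subgroup_axioms] by blast
    then show ?thesis by simp
  qed
  have surj: "carrier H = f ` carrier G" using epi by (simp add: epi_def)
  have dist: "norm_dist H \<mu> (f x) (f y) = norm_dist G \<nu> x y" if "x \<in> carrier G" "y \<in> carrier G" for x y
    using pres[of "inv\<^bsub>G\<^esub> x \<otimes>\<^bsub>G\<^esub> y"] that by (simp add: norm_dist_def)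
  show "isometry (G Mod G.null_elements) (\<lambda>C. the_elem (\<nu> ` C))
      (H Mod H.null_elements) (\<lambda>C. the_elem (\<mu> ` C)) (\<lambda>C. the_elem (cls ` C))"
    unfolding isometry_def carrier_FactGroup
  proof (intro conjI ballI)
    show "bij_betw (\<lambda>C. the_elem (cls ` C)) ((#>\<^bsub>G\<^esub>) G.null_elements ` carrier G)
        ((#>\<^bsub>H\<^esub>) H.null_elements ` carrier H)"
      unfolding bij_betw_def
    proof
      show "inj_on (\<lambda>C. the_elem (cls ` C)) ((#>\<^bsub>G\<^esub>) G.null_elements ` carrier G)"
        by (auto simp: inj_on_def the cls_eq)
      show "(\<lambda>C. the_elem (cls ` C)) ` (#>\<^bsub>G\<^esub>) G.null_elements ` carrier G =
          (#>\<^bsub>H\<^esub>) H.null_elements ` carrier H"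
        unfolding surj image_image using the by (auto simp: cls_def intro!: image_eqI)
    qed
    fix C D assume "C \<in> (#>\<^bsub>G\<^esub>) G.null_elements ` carrier G" "D \<in> (#>\<^bsub>G\<^esub>) G.null_elements ` carrier G"
    then obtain x y where xy: "x \<in> carrier G" "y \<in> carrier G"
        "C = G.null_elements #>\<^bsub>G\<^esub> x" "D = G.null_elements #>\<^bsub>G\<^esub> y"
      by blast
    then show "norm_dist (H Mod H.null_elements) (\<lambda>C. the_elem (\<mu> ` C))
        (the_elem (cls ` C)) (the_elem (cls ` D)) =
        norm_dist (G Mod G.null_elements) (\<lambda>C. the_elem (\<nu> ` C)) C D"
      by (simp add: the G.norm_dist_quotient dist) (simp add: cls_def H.norm_dist_quotient dist)
  qed
qed

subsection \<open>Metric quotients\<close>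

context
  fixes G :: "('a, 'm) monoid_scheme" and H :: "('b, 'n) monoid_scheme" and \<nu> \<mu> \<pi>
  assumes quot: "metric_quotient G \<nu> H \<mu> \<pi>"
    and G: "pseudonormed_group G \<nu>"
begin

lemma metric_quotient_surj:
  assumes "h \<in> carrier H"
  obtains g where "g \<in> carrier G" "\<pi> g = h"
proof -
  have "h \<in> \<pi> ` carrier G" using quot assms by (simp add: metric_quotient_def epi_def)
  then show ?thesis using that by blast
qed

lemma metric_quotient_le:
  assumes "g \<in> carrier G"
  shows "\<mu> (\<pi> g) \<le> \<nu> g"
proof -
  have "\<pi> g \<in> carrier H" using quot assms by (auto simp: metric_quotient_def epi_def hom_def)
  then have "\<mu> (\<pi> g) = Inf {\<nu> g' | g'. g' \<in> carrier G \<and> \<pi> g' = \<pi> g}"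
    using quot by (simp add: metric_quotient_def)
  also have "\<dots> \<le> \<nu> g"
    using assms pseudonormed_group.norm_nonneg[OF G] by (intro cInf_lower) (auto intro!: bdd_belowI[of _ 0])
  finally show ?thesis .
qed

lemma metric_quotient_lift:
  assumes "h \<in> carrier H" "\<mu> h < c"
  obtains g where "g \<in> carrier G" "\<pi> g = h" "\<nu> g < c"
proof -
  have "{\<nu> g | g. g \<in> carrier G \<and> \<pi> g = h} \<noteq> {}"
    using metric_quotient_surj[OF assms(1)] by blast
  moreover have "Inf {\<nu> g | g. g \<in> carrier G \<and> \<pi> g = h} < c"
    using quot assms by (auto simp: metric_quotient_def)
  ultimately have "\<exists>a\<in>{\<nu> g | g. g \<in> carrier G \<and> \<pi> g = h}. a < c"
    by (rule cInf_lessD)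
  then show ?thesis using that by blast
qed

lemma metric_quotient_pseudonormed:
  assumes H: "group H"
  shows "pseudonormed_group H \<mu>"
proof -
  interpret G: pseudonormed_group G \<nu> by (rule G)
  interpret H: group H by (rule H)
  interpret \<pi>: group_hom G H \<pi>
    using quot by unfold_locales (simp add: metric_quotient_def epi_def)
  let ?R = "\<lambda>h c. \<exists>g. c = \<nu> g \<and> g \<in> carrier G \<and> \<pi> g = h"
  have *: "pseudonormed_group H (\<lambda>h. Inf {c. ?R h c})"
  proof (rule H.pseudonormed_group_Inf)
    show "\<exists>c. ?R h c" if "h \<in> carrier H" for h
      using metric_quotient_surj[OF that] by metis
    show "0 \<le> c" if "?R h c" for h c
      using that G.norm_nonneg by auto
    show "?R \<one>\<^bsub>H\<^esub> 0"
      using G.norm_one by (intro exI[of _ "\<one>\<^bsub>G\<^esub>"]) simp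
    show "\<exists>e\<le>c + d. ?R (x \<otimes>\<^bsub>H\<^esub> y) e" if "?R x c" "?R y d" for x y c d
      using that G.norm_mult by (metis G.m_closed \<pi>.hom_mult)
    show "?R (inv\<^bsub>H\<^esub> x) c" if "?R x c" for x c
      using that G.norm_inv by (metis G.inv_closed \<pi>.hom_inv)
    show "?R (h \<otimes>\<^bsub>H\<^esub> x \<otimes>\<^bsub>H\<^esub> inv\<^bsub>H\<^esub> h) c" if R: "?R x c" and h: "h \<in> carrier H" for x h c
    proof -
      obtain g where g: "c = \<nu> g" "g \<in> carrier G" "\<pi> g = x" using R by blast
      obtain k where "k \<in> carrier G" "\<pi> k = h"
        using metric_quotient_surj[OF h] by blast
      with g show ?thesis
        using G.norm_conj by (intro exI[of _ "k \<otimes>\<^bsub>G\<^esub> g \<otimes>\<^bsub>G\<^esub> inv\<^bsub>G\<^esub> k"]) simp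
    qed
  qed
  interpret Q: pseudonormed_group H "\<lambda>h. Inf {c. ?R h c}" by (rule *)
  have \<mu>: "\<mu> h = Inf {c. ?R h c}" if "h \<in> carrier H" for h
    using that quot by (simp add: metric_quotient_def)
  show ?thesis
    by unfold_locales (use Q.norm_nonneg Q.norm_one Q.norm_inv Q.norm_mult Q.norm_conj in \<open>simp_all add: \<mu>\<close>)
qed

end

section \<open>The free product of copies of the reals\<close>

lemma FR_induct [consumes 1, case_names one mult]:
  assumes "x \<in> carrier (FR G)"
    and one: "P \<one>\<^bsub>FR G\<^esub>"
    and mult: "\<And>g r y. g \<in> carrier G \<Longrightarrow> y \<in> carrier (FR G) \<Longrightarrow> P y \<Longrightarrow> P (syl g r \<otimes>\<^bsub>FR G\<^esub> y)"
  shows "P x"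
  using assms(1)
proof (induction x)
  case Nil
  then show ?case using one by (simp add: FR_def)
next
  case (Cons p y)
  obtain g r where p: "p = (g, r)" by fastforce
  have y: "y \<in> carrier (FR G)" and g: "g \<in> carrier G" and r: "r \<noteq> 0"
    using Cons.prems by (auto simp: FR_def reduced_def distinct_adj_Cons p)
  have "syl g r \<otimes>\<^bsub>FR G\<^esub> y = p # y"
    using Cons.prems r by (cases y) (auto simp: FR_def reduced_def syl_def p)
  then show ?case using mult[OF g y Cons.IH[OF y], of r] by simp
qed

lemma FR_hom_eqI:
  assumes "\<alpha> \<in> hom (FR G) M" "\<beta> \<in> hom (FR G) M" "group M"
    and "\<And>g r. g \<in> carrier G \<Longrightarrow> \<alpha> (syl g r) = \<beta> (syl g r)"
    and "x \<in> carrier (FR G)"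
  shows "\<alpha> x = \<beta> x"
  using assms(5)
proof (induction rule: FR_induct)
  case one
  show ?case using assms(1-3) by (simp add: group_FR hom_one)
next
  case (mult g r y)
  then show ?case
    using hom_mult[OF assms(1), of "syl g r" y] hom_mult[OF assms(2), of "syl g r" y] assms(4)
    by (simp add: syl_closed)
qed

subsection \<open>The pseudonorm\<close>

text \<open>The costs of the factorisations over which \<^const>\<open>FR_norm\<close> takes the infimum.  The exponent
  \<open>\<plusminus>1\<close> is absorbed into the sign of the real number.\<close>

inductive FR_cost :: "('a, 'm) monoid_scheme \<Rightarrow> ('a \<Rightarrow> real) \<Rightarrow> 'a word \<Rightarrow> real \<Rightarrow> bool"
  for G \<nu> where
  FR_cost_one: "FR_cost G \<nu> \<one>\<^bsub>FR G\<^esub> 0"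
| FR_cost_step: "h \<in> carrier (FR G) \<Longrightarrow> g \<in> carrier G \<Longrightarrow> FR_cost G \<nu> y c \<Longrightarrow>
    FR_cost G \<nu> (h \<otimes>\<^bsub>FR G\<^esub> syl g r \<otimes>\<^bsub>FR G\<^esub> inv\<^bsub>FR G\<^esub> h \<otimes>\<^bsub>FR G\<^esub> y) (\<bar>r\<bar> * \<nu> g + c)"

lemma FR_norm_eq_Inf_cost: "FR_norm G \<nu> x = Inf {c. FR_cost G \<nu> x c}"
proof -
  interpret group "FR G" by (rule group_FR)
  let ?f = "\<lambda>(h, g, r, e) y. (h \<otimes>\<^bsub>FR G\<^esub> (syl g r [^]\<^bsub>FR G\<^esub> (e::int)) \<otimes>\<^bsub>FR G\<^esub> inv\<^bsub>FR G\<^esub> h) \<otimes>\<^bsub>FR G\<^esub> y"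
  let ?S = "carrier (FR G) \<times> carrier G \<times> UNIV \<times> {1, -1}"
  let ?c = "\<lambda>L. sum_list (map (\<lambda>(h, g, r, e). \<bar>r\<bar> * \<nu> g) L)"
  have "FR_cost G \<nu> (foldr ?f L \<one>\<^bsub>FR G\<^esub>) (?c L)" if "set L \<subseteq> ?S" for L
    using that
  proof (induction L)
    case Nil
    show ?case by (simp add: FR_cost_one)
  next
    case (Cons q L)
    obtain h g r e where q: "q = (h, g, r, e)" by (cases q)
    have *: "h \<in> carrier (FR G)" "g \<in> carrier G" "e = 1 \<or> e = -1"
      using Cons.prems by (auto simp: q)
    then have "syl g r [^]\<^bsub>FR G\<^esub> e = syl g (of_int e * r)"
      using int_pow_neg[of "syl g r" 1] by (auto simp: syl_closed inv_syl)
    moreover have "\<bar>of_int e * r\<bar> = \<bar>r\<bar>" using * by auto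
    ultimately show ?case
      using FR_cost_step[OF *(1,2) Cons.IH, where r = "of_int e * r"] Cons.prems by (simp add: q)
  qed
  moreover have "\<exists>L. set L \<subseteq> ?S \<and> x = foldr ?f L \<one>\<^bsub>FR G\<^esub> \<and> c = ?c L" if "FR_cost G \<nu> x c" for c
    using that
  proof induction
    case FR_cost_one
    show ?case by (intro exI[of _ "[]"]) simp
  next
    case (FR_cost_step h g y c r)
    then obtain L where "set L \<subseteq> ?S" "y = foldr ?f L \<one>\<^bsub>FR G\<^esub>" "c = ?c L" by blast
    with FR_cost_step.hyps show ?case
      by (intro exI[of _ "(h, g, r, 1) # L"]) (simp add: syl_closed)
  qed
  ultimately have "{?c L | L. set L \<subseteq> ?S \<and> x = foldr ?f L \<one>\<^bsub>FR G\<^esub>} = {c. FR_cost G \<nu> x c}"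
    by blast
  then show ?thesis unfolding FR_norm_def by simp
qed

context
  fixes G :: "('a, 'm) monoid_scheme" and \<nu> :: "'a \<Rightarrow> real"
  assumes nonneg: "\<And>g. g \<in> carrier G \<Longrightarrow> 0 \<le> \<nu> g"
begin

interpretation group "FR G" by (rule group_FR)

lemma FR_cost_nonneg: "FR_cost G \<nu> x c \<Longrightarrow> 0 \<le> c"
  by (induction rule: FR_cost.induct) (auto simp: nonneg)

lemma FR_cost_closed: "FR_cost G \<nu> x c \<Longrightarrow> x \<in> carrier (FR G)"
  by (induction rule: FR_cost.induct) (auto simp: syl_closed)

lemma FR_cost_syl:
  assumes "g \<in> carrier G"
  shows "FR_cost G \<nu> (syl g r) (\<bar>r\<bar> * \<nu> g)"
  using FR_cost_step[OF one_closed assms FR_cost_one, where r = r] assms by (simp add: syl_closed)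

lemma FR_cost_mult:
  assumes "FR_cost G \<nu> x c" "FR_cost G \<nu> y d"
  shows "FR_cost G \<nu> (x \<otimes>\<^bsub>FR G\<^esub> y) (c + d)"
  using assms(1)
proof induction
  case FR_cost_one
  then show ?case using assms(2) by (simp add: FR_cost_closed)
next
  case (FR_cost_step h g z c r)
  then have "z \<in> carrier (FR G)" "y \<in> carrier (FR G)" using assms(2) by (auto dest: FR_cost_closed)
  with FR_cost.FR_cost_step[OF FR_cost_step.hyps(1,2) FR_cost_step.IH, where r = r] FR_cost_step.hyps
  show ?case by (simp add: m_assoc syl_closed add.assoc)
qed

lemma FR_cost_conj:
  assumes "FR_cost G \<nu> x c" "k \<in> carrier (FR G)"
  shows "FR_cost G \<nu> (k \<otimes>\<^bsub>FR G\<^esub> x \<otimes>\<^bsub>FR G\<^esub> inv\<^bsub>FR G\<^esub> k) c"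
  using assms(1)
proof induction
  case FR_cost_one
  then show ?case using assms(2) FR_cost.FR_cost_one[of G \<nu>] by simp
next
  case (FR_cost_step h g z c r)
  have "z \<in> carrier (FR G)" using FR_cost_step by (auto dest: FR_cost_closed)
  moreover have "k \<otimes>\<^bsub>FR G\<^esub> h \<in> carrier (FR G)" using FR_cost_step assms(2) by simp
  note FR_cost.FR_cost_step[OF this FR_cost_step.hyps(2) FR_cost_step.IH, where r = r]
  ultimately show ?case
    using FR_cost_step.hyps(1,2) assms(2) by (simp add: m_assoc syl_closed inv_mult_group)
qed

lemma FR_cost_inv:
  assumes "FR_cost G \<nu> x c"
  shows "FR_cost G \<nu> (inv\<^bsub>FR G\<^esub> x) c"
  using assms
proof induction
  case FR_cost_one
  then show ?case using FR_cost.FR_cost_one[of G \<nu>] by simp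
next
  case (FR_cost_step h g z c r)
  have "z \<in> carrier (FR G)" using FR_cost_step by (auto dest: FR_cost_closed)
  moreover have "FR_cost G \<nu> (inv\<^bsub>FR G\<^esub> z \<otimes>\<^bsub>FR G\<^esub> (h \<otimes>\<^bsub>FR G\<^esub> syl g (- r) \<otimes>\<^bsub>FR G\<^esub> inv\<^bsub>FR G\<^esub> h))
      (c + \<bar>- r\<bar> * \<nu> g)"
    by (intro FR_cost_mult FR_cost_step.IH FR_cost_conj FR_cost_syl FR_cost_step.hyps)
  ultimately show ?case
    using FR_cost_step.hyps(1,2)
    by (simp add: m_assoc syl_closed inv_mult_group inv_syl add.commute)
qed

lemma FR_cost_ex:
  assumes "x \<in> carrier (FR G)"
  shows "\<exists>c. FR_cost G \<nu> x c"
  using assms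
proof (induction rule: FR_induct)
  case one
  show ?case using FR_cost_one by blast
next
  case (mult g r y)
  then show ?case using FR_cost_mult[OF FR_cost_syl] by blast
qed

lemma pseudonormed_group_FR: "pseudonormed_group (FR G) (FR_norm G \<nu>)"
proof -
  have "pseudonormed_group (FR G) (\<lambda>x. Inf {c. FR_cost G \<nu> x c})"
  proof (rule pseudonormed_group_Inf)
    show "\<exists>e\<le>c + d. FR_cost G \<nu> (x \<otimes>\<^bsub>FR G\<^esub> y) e" if "FR_cost G \<nu> x c" "FR_cost G \<nu> y d" for x y c d
      using FR_cost_mult[OF that] by blast
  qed (fact FR_cost_ex FR_cost_nonneg FR_cost_one | erule FR_cost_inv | rule FR_cost_conj; assumption)+
  then show ?thesis by (simp add: FR_norm_eq_Inf_cost[abs_def])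
qed

lemma FR_norm_le_cost: "FR_cost G \<nu> x c \<Longrightarrow> FR_norm G \<nu> x \<le> c"
  unfolding FR_norm_eq_Inf_cost
  by (intro cInf_lower) (auto intro!: bdd_belowI[of _ 0] FR_cost_nonneg)

lemma FR_norm_greatest:
  assumes "x \<in> carrier (FR G)" "\<And>c. FR_cost G \<nu> x c \<Longrightarrow> b \<le> c"
  shows "b \<le> FR_norm G \<nu> x"
  unfolding FR_norm_eq_Inf_cost using assms FR_cost_ex by (intro cInf_greatest) auto

end

subsection \<open>The free subgroup\<close>

lemma subgroup_F_grp: "subgroup (carrier (F_grp G)) (FR G)"
  unfolding F_grp_def by (auto intro!: group.generate_is_subgroup[OF group_FR] syl_closed)

lemma group_F_grp: "group (F_grp G)"
  using group.subgroup_imp_group[OF group_FR subgroup_F_grp] by (simp add: F_grp_def)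

lemma F_grp_simps [simp]:
  "monoid.mult (F_grp G) = monoid.mult (FR G)" "one (F_grp G) = one (FR G)"
  by (simp_all add: F_grp_def)

lemma inv_F_grp: "x \<in> carrier (F_grp G) \<Longrightarrow> inv\<^bsub>F_grp G\<^esub> x = inv\<^bsub>FR G\<^esub> x"
  using group.m_inv_consistent[OF group_FR subgroup_F_grp] by (simp add: F_grp_def)

lemma F_grp_subset: "x \<in> carrier (F_grp G) \<Longrightarrow> x \<in> carrier (FR G)"
  using subgroup.subset[OF subgroup_F_grp] by blast

lemma syl_in_F_grp: "g \<in> carrier G \<Longrightarrow> syl g 1 \<in> carrier (F_grp G)"
  unfolding F_grp_def by (auto intro: generate.incl)

lemma F_grp_induct [consumes 1, case_names one syl inv mult]:
  assumes "x \<in> carrier (F_grp G)"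
    and one: "P \<one>\<^bsub>FR G\<^esub>"
    and syl: "\<And>g. g \<in> carrier G \<Longrightarrow> P (syl g 1)"
    and inv: "\<And>g. g \<in> carrier G \<Longrightarrow> P (syl g 1) \<Longrightarrow> P (inv\<^bsub>FR G\<^esub> syl g 1)"
    and mult: "\<And>x y. x \<in> carrier (F_grp G) \<Longrightarrow> y \<in> carrier (F_grp G) \<Longrightarrow> P x \<Longrightarrow> P y \<Longrightarrow> P (x \<otimes>\<^bsub>FR G\<^esub> y)"
  shows "P x"
proof -
  have "x \<in> generate (FR G) {syl g 1 | g. g \<in> carrier G}" using assms(1) by (simp add: F_grp_def)
  then show ?thesis
  proof induction
    case (eng x y)
    then show ?case using mult[of x y] by (simp add: F_grp_def)
  qed (use one syl inv in auto)
qed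

lemma F_grp_hom_eqI:
  assumes "\<alpha> \<in> hom (F_grp G) M" "\<beta> \<in> hom (F_grp G) M" "group M"
    and "\<And>g. g \<in> carrier G \<Longrightarrow> \<alpha> (syl g 1) = \<beta> (syl g 1)"
    and "x \<in> carrier (F_grp G)"
  shows "\<alpha> x = \<beta> x"
proof -
  interpret \<alpha>: group_hom "F_grp G" M \<alpha>
    using assms(1,3) group_F_grp by (simp add: group_hom_def group_hom_axioms_def)
  interpret \<beta>: group_hom "F_grp G" M \<beta>
    using assms(2,3) group_F_grp by (simp add: group_hom_def group_hom_axioms_def)
  show ?thesis
    using assms(5)
  proof (induction rule: F_grp_induct)
    case one
    show ?case using \<alpha>.hom_one \<beta>.hom_one by simp
  next
    case (inv g)
    then show ?case using \<alpha>.hom_inv[of "syl g 1"] \<beta>.hom_inv[of "syl g 1"]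
      by (simp add: syl_in_F_grp inv_F_grp)
  next
    case (mult x y)
    then show ?case using \<alpha>.hom_mult[of x y] \<beta>.hom_mult[of x y] by simp
  qed (rule assms(4))
qed

subsection \<open>Relabelling the free factors\<close>

definition relabel :: "('b, 'n) monoid_scheme \<Rightarrow> ('a \<Rightarrow> 'b) \<Rightarrow> 'a word \<Rightarrow> 'b word" where
  "relabel H f = word_eval (FR H) (\<lambda>g r. syl (f g) r)"

context
  fixes G :: "('a, 'm) monoid_scheme" and H :: "('b, 'n) monoid_scheme" and f
  assumes f: "f \<in> carrier G \<rightarrow> carrier H"
begin

lemma relabel_hom: "relabel H f \<in> hom (FR G) (FR H)"
  and relabel_syl: "g \<in> carrier G \<Longrightarrow> relabel H f (syl g r) = syl (f g) r"
proof -
  have *: "syllable_map G (FR H) UNIV (\<lambda>g r. syl (f g) r)"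
    using f by (intro syllable_map.intro)
      (auto simp: group_FR syl_add[of _ _ _ H] Pi_iff intro!: syl_closed, simp add: FR_def)
  show "relabel H f \<in> hom (FR G) (FR H)" "g \<in> carrier G \<Longrightarrow> relabel H f (syl g r) = syl (f g) r"
    using word_eval_hom[OF *] by (auto simp: relabel_def)
qed

interpretation group_hom "FR G" "FR H" "relabel H f"
  using relabel_hom by (simp add: group_hom_def group_hom_axioms_def group_FR)

lemma relabel_F_grp_closed:
  assumes "x \<in> carrier (F_grp G)"
  shows "relabel H f x \<in> carrier (F_grp H)"
  using assms
proof (induction rule: F_grp_induct)
  case one
  show ?case by (simp add: subgroup.one_closed[OF subgroup_F_grp])
next
  case (syl g)
  then show ?case using f by (auto simp: relabel_syl intro: syl_in_F_grp)
next
  case (inv g)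
  then show ?case by (simp add: subgroup.m_inv_closed[OF subgroup_F_grp] syl_closed)
next
  case (mult x y)
  then show ?case
    by (simp add: subgroup.m_closed[OF subgroup_F_grp] F_grp_subset)
qed

lemma relabel_hom_F_grp: "relabel H f \<in> hom (F_grp G) (F_grp H)"
  by (rule homI) (auto simp: relabel_F_grp_closed F_grp_subset)

lemma relabel_\<psi>:
  assumes "x \<in> carrier (FR G)"
  shows "\<psi> H t (relabel H f x) = relabel H f (\<psi> G t x)"
proof -
  have "(\<psi> H t \<circ> relabel H f) x = (relabel H f \<circ> \<psi> G t) x"
  proof (rule FR_hom_eqI[OF _ _ group_FR _ assms])
    show "\<psi> H t \<circ> relabel H f \<in> hom (FR G) (FR H)" "relabel H f \<circ> \<psi> G t \<in> hom (FR G) (FR H)"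
      using Group.hom_compose[OF relabel_hom \<psi>_hom(1)] Group.hom_compose[OF \<psi>_hom(1) relabel_hom] by auto
    show "(\<psi> H t \<circ> relabel H f) (syl g r) = (relabel H f \<circ> \<psi> G t) (syl g r)" if "g \<in> carrier G" for g r
      using that f by (auto simp: \<psi>_hom relabel_syl Pi_iff)
  qed
  then show ?thesis by simp
qed

text \<open>A relabelling need not come from a homomorphism, and this is essential: it applies to set-theoretic
  sections.  The norm of the free product only sees the norms of the labels.\<close>

lemma relabel_lipschitz:
  assumes "\<And>g. g \<in> carrier G \<Longrightarrow> 0 \<le> \<nu> g" "\<And>h. h \<in> carrier H \<Longrightarrow> 0 \<le> \<mu> h"
    and C: "C > 0" and lip: "\<And>g. g \<in> carrier G \<Longrightarrow> \<mu> (f g) \<le> C * \<nu> g"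
    and x: "x \<in> carrier (FR G)"
  shows "FR_norm H \<mu> (relabel H f x) \<le> C * FR_norm G \<nu> x"
proof -
  have cost: "\<exists>d\<le>C * c. FR_cost H \<mu> (relabel H f x) d" if "FR_cost G \<nu> x c" for x c
    using that
  proof induction
    case FR_cost_one
    show ?case using FR_cost.FR_cost_one[of H \<mu>] by auto
  next
    case (FR_cost_step h g y c r)
    then obtain d where d: "d \<le> C * c" "FR_cost H \<mu> (relabel H f y) d" by blast
    have y: "y \<in> carrier (FR G)" using FR_cost_step assms(1) by (blast intro: FR_cost_closed)
    have "\<bar>r\<bar> * \<mu> (f g) \<le> \<bar>r\<bar> * (C * \<nu> g)"
      using lip FR_cost_step.hyps(2) by (intro mult_left_mono) auto
    then have "\<bar>r\<bar> * \<mu> (f g) + d \<le> C * (\<bar>r\<bar> * \<nu> g + c)" using d(1) by (simp add: algebra_simps)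
    moreover have "f g \<in> carrier H" using FR_cost_step.hyps(2) f by auto
    then have "FR_cost H \<mu> (relabel H f h \<otimes>\<^bsub>FR H\<^esub> syl (f g) r \<otimes>\<^bsub>FR H\<^esub> inv\<^bsub>FR H\<^esub> relabel H f h
        \<otimes>\<^bsub>FR H\<^esub> relabel H f y) (\<bar>r\<bar> * \<mu> (f g) + d)"
      using FR_cost_step.hyps(1) d(2) by (intro FR_cost.FR_cost_step) auto
    ultimately show ?case
      using FR_cost_step.hyps(1,2) y by (intro exI[of _ "\<bar>r\<bar> * \<mu> (f g) + d"]) (simp add: syl_closed relabel_syl)
  qed
  have "FR_norm H \<mu> (relabel H f x) / C \<le> FR_norm G \<nu> x"
  proof (rule FR_norm_greatest[OF assms(1) x])
    fix c assume "FR_cost G \<nu> x c"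
    then obtain d where "d \<le> C * c" "FR_cost H \<mu> (relabel H f x) d" using cost by blast
    then have "FR_norm H \<mu> (relabel H f x) \<le> C * c" using FR_norm_le_cost[of H \<mu>, OF assms(2)] by force
    then show "FR_norm H \<mu> (relabel H f x) / C \<le> c" using C by (simp add: divide_le_eq mult.commute)
  qed
  then show ?thesis using C by (simp add: divide_le_eq mult.commute)
qed

end

section \<open>The directional asymptotic cone\<close>

lemma cauchy_along_cong:
  assumes "\<And>t. t \<in> T \<Longrightarrow> f t = g t"
  shows "cauchy_along K \<rho> T f \<longleftrightarrow> cauchy_along K \<rho> T g"
  using assms by (simp add: cauchy_along_def)

locale directional_cone = pseudonormed_group G \<nu>
  for G :: "('a, 'm) monoid_scheme" (structure) and \<nu> +
  fixes T :: "real set"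
  assumes scaling: "scaling_set T"
begin

abbreviation lim_T :: "real filter" where
  "lim_T \<equiv> inf at_top (principal T)"

lemma lim_T_nontrivial: "lim_T \<noteq> bot"
proof
  assume "lim_T = bot"
  then have "eventually (\<lambda>t. t \<notin> T) at_top"
    using eventually_inf_principal[of "\<lambda>_. False" at_top T] by simp
  then obtain M where "\<And>t. t \<ge> M \<Longrightarrow> t \<notin> T" by (auto simp: eventually_at_top_linorder)
  then have "bdd_above T" by (intro bdd_aboveI[of _ M]) (metis nle_le)
  then show False using scaling by (simp add: scaling_set_def)
qed

lemma eventually_lim_T: "(\<And>t. t \<in> T \<Longrightarrow> P t) \<Longrightarrow> eventually P lim_T"
  by (simp add: eventually_inf_principal)

sublocale FR: pseudonormed_group "FR G" "FR_norm G \<nu>"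
  by (rule pseudonormed_group_FR) (rule norm_nonneg)

sublocale \<psi>: group_hom "FR G" "FR G" "\<psi> G t" for t
  by (simp add: group_hom_def group_hom_axioms_def group_FR \<psi>_hom)

subsection \<open>The group of functions into the free group\<close>

lemma carrier_DD:
  "w \<in> carrier (DD G \<nu> T) \<longleftrightarrow> w \<in> T \<rightarrow>\<^sub>E carrier (F_grp G) \<and>
    cauchy_along (FR G) (FR_norm G \<nu>) T (\<lambda>t. \<psi> G (1 / t) (w t))"
  by (simp add: DD_def)

lemma DD_in_FR: "w \<in> carrier (DD G \<nu> T) \<Longrightarrow> t \<in> T \<Longrightarrow> w t \<in> carrier (FR G)"
  by (auto simp: carrier_DD intro: F_grp_subset)

lemma DD_in_F: "w \<in> carrier (DD G \<nu> T) \<Longrightarrow> t \<in> T \<Longrightarrow> w t \<in> carrier (F_grp G)"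
  by (auto simp: carrier_DD)

lemma DD_rescaled: "w \<in> carrier (DD G \<nu> T) \<Longrightarrow> (\<lambda>t. \<psi> G (1 / t) (w t)) \<in> T \<rightarrow> carrier (FR G)"
  by (simp add: DD_in_FR)

lemma DD_simps:
  "v \<otimes>\<^bsub>DD G \<nu> T\<^esub> w = (\<lambda>t\<in>T. v t \<otimes>\<^bsub>FR G\<^esub> w t)"
  "\<one>\<^bsub>DD G \<nu> T\<^esub> = (\<lambda>t\<in>T. \<one>\<^bsub>FR G\<^esub>)"
  by (simp_all add: DD_def product_group_def)

lemma subgroup_DD: "subgroup (carrier (DD G \<nu> T)) (product_group T (\<lambda>_. F_grp G))"
proof -
  interpret P: group "product_group T (\<lambda>_. F_grp G)" by (simp add: group_F_grp)
  interpret F: group "F_grp G" by (rule group_F_grp)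
  show ?thesis
  proof (rule subgroup.intro)
    show "carrier (DD G \<nu> T) \<subseteq> carrier (product_group T (\<lambda>_. F_grp G))"
      by (auto simp: carrier_DD)
  next
    fix v w assume v: "v \<in> carrier (DD G \<nu> T)" and w: "w \<in> carrier (DD G \<nu> T)"
    have "cauchy_along (FR G) (FR_norm G \<nu>) T (\<lambda>t. \<psi> G (1 / t) (v t) \<otimes>\<^bsub>FR G\<^esub> \<psi> G (1 / t) (w t))"
      using v w by (intro FR.cauchy_along_mult DD_rescaled) (auto simp: carrier_DD)
    then have "cauchy_along (FR G) (FR_norm G \<nu>) T (\<lambda>t. \<psi> G (1 / t) ((\<lambda>t\<in>T. v t \<otimes>\<^bsub>FR G\<^esub> w t) t))"
      using v w DD_in_FR by (subst cauchy_along_cong) auto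
    moreover have "(\<lambda>t\<in>T. v t \<otimes>\<^bsub>FR G\<^esub> w t) \<in> T \<rightarrow>\<^sub>E carrier (F_grp G)"
      using v w F.m_closed by (auto simp: carrier_DD)
    ultimately show "v \<otimes>\<^bsub>product_group T (\<lambda>_. F_grp G)\<^esub> w \<in> carrier (DD G \<nu> T)"
      by (simp add: carrier_DD)
  next
    have "cauchy_along (FR G) (FR_norm G \<nu>) T (\<lambda>t. \<psi> G (1 / t) ((\<lambda>t\<in>T. \<one>\<^bsub>FR G\<^esub>) t))"
      using FR.norm_one by (auto simp: cauchy_along_def norm_dist_def)
    then show "\<one>\<^bsub>product_group T (\<lambda>_. F_grp G)\<^esub> \<in> carrier (DD G \<nu> T)"
      using F.one_closed by (simp add: carrier_DD)
  next
    fix w assume w: "w \<in> carrier (DD G \<nu> T)"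
    have "cauchy_along (FR G) (FR_norm G \<nu>) T (\<lambda>t. inv\<^bsub>FR G\<^esub> \<psi> G (1 / t) (w t))"
      using w by (intro FR.cauchy_along_inv DD_rescaled) (auto simp: carrier_DD)
    then have "cauchy_along (FR G) (FR_norm G \<nu>) T (\<lambda>t. \<psi> G (1 / t) ((\<lambda>t\<in>T. inv\<^bsub>F_grp G\<^esub> w t) t))"
      using w DD_in_FR by (subst cauchy_along_cong) (auto simp: DD_in_F[OF w] inv_F_grp)
    moreover have "(\<lambda>t\<in>T. inv\<^bsub>F_grp G\<^esub> w t) \<in> T \<rightarrow>\<^sub>E carrier (F_grp G)"
      using w F.inv_closed by (auto simp: carrier_DD)
    moreover have "w \<in> T \<rightarrow>\<^sub>E carrier (F_grp G)" using w by (simp add: carrier_DD)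
    ultimately show "inv\<^bsub>product_group T (\<lambda>_. F_grp G)\<^esub> w \<in> carrier (DD G \<nu> T)"
      by (simp add: carrier_DD group_F_grp)
  qed
qed

lemma DD_eq: "DD G \<nu> T = (product_group T (\<lambda>_. F_grp G))\<lparr>carrier := carrier (DD G \<nu> T)\<rparr>"
  by (simp add: DD_def)

lemma group_DD: "group (DD G \<nu> T)"
  by (subst DD_eq) (intro group.subgroup_imp_group subgroup_DD product_group group_F_grp)

lemma inv_DD:
  assumes "w \<in> carrier (DD G \<nu> T)"
  shows "inv\<^bsub>DD G \<nu> T\<^esub> w = (\<lambda>t\<in>T. inv\<^bsub>FR G\<^esub> w t)"
proof -
  have w: "w \<in> T \<rightarrow>\<^sub>E carrier (F_grp G)" using assms by (simp add: carrier_DD)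
  have "inv\<^bsub>DD G \<nu> T\<^esub> w = inv\<^bsub>product_group T (\<lambda>_. F_grp G)\<^esub> w"
    using assms by (subst DD_eq) (intro group.m_inv_consistent product_group group_F_grp subgroup_DD)
  also have "\<dots> = (\<lambda>t\<in>T. inv\<^bsub>F_grp G\<^esub> w t)"
    using w by (simp add: group_F_grp)
  also have "\<dots> = (\<lambda>t\<in>T. inv\<^bsub>FR G\<^esub> w t)"
    using w by (intro restrict_ext inv_F_grp) auto
  finally show ?thesis .
qed

lemma DD_norm_eqI:
  assumes "((\<lambda>t. FR_norm G \<nu> (\<psi> G (1 / t) (w t))) \<longlongrightarrow> l) lim_T"
  shows "DD_norm G \<nu> T w = l"
  unfolding DD_norm_def by (rule tendsto_Lim[OF lim_T_nontrivial assms])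

lemma DD_norm_tendsto:
  assumes "w \<in> carrier (DD G \<nu> T)"
  shows "((\<lambda>t. FR_norm G \<nu> (\<psi> G (1 / t) (w t))) \<longlongrightarrow> DD_norm G \<nu> T w) lim_T"
proof -
  obtain l where "((\<lambda>t. FR_norm G \<nu> (\<psi> G (1 / t) (w t))) \<longlongrightarrow> l) lim_T"
    using FR.cauchy_along_norm_convergent[OF DD_rescaled[OF assms] _ lim_T_nontrivial] assms
    by (auto simp: carrier_DD)
  then show ?thesis using DD_norm_eqI by blast
qed

lemma DD_norm_cong:
  assumes "v \<in> carrier (DD G \<nu> T)"
    and "\<And>t. t \<in> T \<Longrightarrow> FR_norm G \<nu> (\<psi> G (1 / t) (w t)) = FR_norm G \<nu> (\<psi> G (1 / t) (v t))"
  shows "DD_norm G \<nu> T w = DD_norm G \<nu> T v"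
  using Lim_transform_eventually[OF DD_norm_tendsto[OF assms(1)] eventually_lim_T] assms(2)
  by (intro DD_norm_eqI) simp

sublocale DD: pseudonormed_group "DD G \<nu> T" "DD_norm G \<nu> T"
proof -
  interpret D: group "DD G \<nu> T" by (rule group_DD)
  show "pseudonormed_group (DD G \<nu> T) (DD_norm G \<nu> T)"
  proof unfold_locales
    show "0 \<le> DD_norm G \<nu> T w" if "w \<in> carrier (DD G \<nu> T)" for w
    proof (rule tendsto_lowerbound[OF DD_norm_tendsto[OF that] _ lim_T_nontrivial])
      show "eventually (\<lambda>t. 0 \<le> FR_norm G \<nu> (\<psi> G (1 / t) (w t))) lim_T"
        using that by (intro eventually_lim_T FR.norm_nonneg) (simp add: DD_in_FR)
    qed
    have "((\<lambda>t. FR_norm G \<nu> (\<psi> G (1 / t) ((\<lambda>t\<in>T. \<one>\<^bsub>FR G\<^esub>) t))) \<longlongrightarrow> 0) lim_T"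
      by (rule tendsto_eventually) (auto intro!: eventually_lim_T simp: FR.norm_one)
    then show "DD_norm G \<nu> T \<one>\<^bsub>DD G \<nu> T\<^esub> = 0"
      unfolding DD_simps by (rule DD_norm_eqI)
    show "DD_norm G \<nu> T (inv\<^bsub>DD G \<nu> T\<^esub> w) = DD_norm G \<nu> T w" if "w \<in> carrier (DD G \<nu> T)" for w
      using that DD_in_FR by (intro DD_norm_cong) (auto simp: inv_DD FR.norm_inv)
    show "DD_norm G \<nu> T (v \<otimes>\<^bsub>DD G \<nu> T\<^esub> w) \<le> DD_norm G \<nu> T v + DD_norm G \<nu> T w"
      if v: "v \<in> carrier (DD G \<nu> T)" and w: "w \<in> carrier (DD G \<nu> T)" for v w
    proof (rule tendsto_le[OF lim_T_nontrivial tendsto_add[OF DD_norm_tendsto[OF v] DD_norm_tendsto[OF w]]])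
      show "((\<lambda>t. FR_norm G \<nu> (\<psi> G (1 / t) ((v \<otimes>\<^bsub>DD G \<nu> T\<^esub> w) t))) \<longlongrightarrow> DD_norm G \<nu> T (v \<otimes>\<^bsub>DD G \<nu> T\<^esub> w)) lim_T"
        using v w by (intro DD_norm_tendsto) simp
      show "eventually (\<lambda>t. FR_norm G \<nu> (\<psi> G (1 / t) ((v \<otimes>\<^bsub>DD G \<nu> T\<^esub> w) t))
          \<le> FR_norm G \<nu> (\<psi> G (1 / t) (v t)) + FR_norm G \<nu> (\<psi> G (1 / t) (w t))) lim_T"
        using v w DD_in_FR by (intro eventually_lim_T) (simp add: DD_simps FR.norm_mult)
    qed
    show "DD_norm G \<nu> T (v \<otimes>\<^bsub>DD G \<nu> T\<^esub> w \<otimes>\<^bsub>DD G \<nu> T\<^esub> inv\<^bsub>DD G \<nu> T\<^esub> v) = DD_norm G \<nu> T w"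
      if "w \<in> carrier (DD G \<nu> T)" "v \<in> carrier (DD G \<nu> T)" for v w
      using that DD_in_FR by (intro DD_norm_cong) (auto simp: inv_DD DD_simps FR.norm_conj)
  qed
qed

subsection \<open>The group of functions into the base group\<close>

abbreviation eval_DD :: "(real \<Rightarrow> 'a word) \<Rightarrow> real \<Rightarrow> 'a" where
  "eval_DD w \<equiv> (\<lambda>t\<in>T. \<pi>\<^sub>F G (w t))"

lemma eval_DD_hom: "eval_DD \<in> hom (DD G \<nu> T) (product_group T (\<lambda>_. G))"
proof (rule homI)
  show "eval_DD w \<in> carrier (product_group T (\<lambda>_. G))" if "w \<in> carrier (DD G \<nu> T)" for w
    using that hom_carrier[OF \<pi>\<^sub>F_hom(1)[OF is_group]] by (auto simp: carrier_DD)
  show "eval_DD (v \<otimes>\<^bsub>DD G \<nu> T\<^esub> w) = eval_DD v \<otimes>\<^bsub>product_group T (\<lambda>_. G)\<^esub> eval_DD w"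
    if "v \<in> carrier (DD G \<nu> T)" "w \<in> carrier (DD G \<nu> T)" for v w
    using that hom_mult[OF \<pi>\<^sub>F_hom(1)[OF is_group]] by (simp add: DD_simps DD_in_F cong: restrict_cong)
qed

lemma carrier_CC: "carrier (CC G \<nu> T) = eval_DD ` carrier (DD G \<nu> T)"
  by (auto simp: CC_def)

lemma CC_simps:
  "g \<otimes>\<^bsub>CC G \<nu> T\<^esub> h = (\<lambda>t\<in>T. g t \<otimes> h t)" "\<one>\<^bsub>CC G \<nu> T\<^esub> = (\<lambda>t\<in>T. \<one>)"
  by (simp_all add: CC_def product_group_def)

lemma subgroup_CC: "subgroup (carrier (CC G \<nu> T)) (product_group T (\<lambda>_. G))"
proof -
  interpret group_hom "DD G \<nu> T" "product_group T (\<lambda>_. G)" eval_DD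
    using eval_DD_hom by (simp add: group_hom_def group_hom_axioms_def group_DD is_group)
  show ?thesis unfolding carrier_CC by (rule img_is_subgroup)
qed

lemma CC_eq: "CC G \<nu> T = (product_group T (\<lambda>_. G))\<lparr>carrier := carrier (CC G \<nu> T)\<rparr>"
  by (simp add: CC_def)

lemma group_CC: "group (CC G \<nu> T)"
  by (subst CC_eq) (intro group.subgroup_imp_group subgroup_CC product_group is_group)

lemma CC_in_G: "g \<in> carrier (CC G \<nu> T) \<Longrightarrow> t \<in> T \<Longrightarrow> g t \<in> carrier G"
  using subgroup.subset[OF subgroup_CC] by (auto simp: PiE_iff)

lemma inv_CC:
  assumes "g \<in> carrier (CC G \<nu> T)"
  shows "inv\<^bsub>CC G \<nu> T\<^esub> g = (\<lambda>t\<in>T. inv g t)"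
proof -
  have "inv\<^bsub>CC G \<nu> T\<^esub> g = inv\<^bsub>product_group T (\<lambda>_. G)\<^esub> g"
    using assms by (subst CC_eq) (intro group.m_inv_consistent product_group is_group subgroup_CC)
  then show ?thesis
    using subgroup.subset[OF subgroup_CC] assms is_group by (subst (asm) inv_product_group) auto
qed

text \<open>The norm of \<^const>\<open>CC\<close> is by definition the quotient pseudonorm of the one of \<^const>\<open>DD\<close>.\<close>

lemma metric_quotient_DD_CC:
  "metric_quotient (DD G \<nu> T) (DD_norm G \<nu> T) (CC G \<nu> T) (CC_norm G \<nu> T) eval_DD"
proof -
  have "eval_DD \<in> hom (DD G \<nu> T) (CC G \<nu> T)"
    using hom_mult[OF eval_DD_hom] by (intro homI) (auto simp: carrier_CC CC_simps)
  then show ?thesis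
    by (auto simp: metric_quotient_def epi_def carrier_CC CC_norm_def)
qed

sublocale CC: pseudonormed_group "CC G \<nu> T" "CC_norm G \<nu> T"
  by (rule metric_quotient_pseudonormed[OF metric_quotient_DD_CC DD.pseudonormed_group_axioms group_CC])

lemma null_subgroup_eq: "null_subgroup G \<nu> T = CC.null_elements"
  by (simp add: null_subgroup_def CC.null_elements_def)

text \<open>A bounded function \<open>g\<close> is represented by the single letters \<open>g t\<close>, whose norms are divided by
  \<open>t\<close> under rescaling.\<close>

lemma CC_norm_bounded:
  assumes g: "g \<in> T \<rightarrow>\<^sub>E carrier G" and K: "\<And>t. t \<in> T \<Longrightarrow> \<nu> (g t) \<le> K"
  shows "g \<in> carrier (CC G \<nu> T)" and "CC_norm G \<nu> T g = 0"
proof -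
  define w where "w = (\<lambda>t\<in>T. syl (g t) 1)"
  have w_t: "w t = syl (g t) 1" "g t \<in> carrier G" "t > 0" if "t \<in> T" for t
    using that g scaling by (auto simp: w_def scaling_set_def)
  have norm: "FR_norm G \<nu> (\<psi> G (1 / t) (w t)) \<le> K / t" if t: "t \<in> T" for t
  proof -
    have "FR_cost G \<nu> (syl (g t) (1 / t)) (\<bar>1 / t\<bar> * \<nu> (g t))"
      by (intro FR_cost_syl norm_nonneg w_t t)
    then have "FR_norm G \<nu> (syl (g t) (1 / t)) \<le> \<bar>1 / t\<bar> * \<nu> (g t)"
      using FR_norm_le_cost[of G \<nu>] norm_nonneg by blast
    moreover have "\<psi> G (1 / t) (w t) = syl (g t) (1 / t)"
      using w_t[OF t] by (simp add: \<psi>_hom)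
    ultimately have "FR_norm G \<nu> (\<psi> G (1 / t) (w t)) \<le> \<bar>1 / t\<bar> * \<nu> (g t)" by simp
    also have "\<dots> \<le> K / t"
      using K[OF t] w_t(3)[OF t] by (simp add: divide_right_mono)
    finally show ?thesis .
  qed
  have closed: "(\<lambda>t. \<psi> G (1 / t) (w t)) \<in> T \<rightarrow> carrier (FR G)"
    using w_t by (auto simp: syl_closed)
  have lim: "((\<lambda>t. FR_norm G \<nu> (\<psi> G (1 / t) (w t))) \<longlongrightarrow> 0) lim_T"
  proof (rule tendsto_sandwich)
    show "eventually (\<lambda>t. 0 \<le> FR_norm G \<nu> (\<psi> G (1 / t) (w t))) lim_T"
      using closed by (intro eventually_lim_T FR.norm_nonneg) auto
    show "eventually (\<lambda>t. FR_norm G \<nu> (\<psi> G (1 / t) (w t)) \<le> K / t) lim_T"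
      by (intro eventually_lim_T norm)
    show "((\<lambda>t. K / t) \<longlongrightarrow> 0) lim_T"
      by (rule tendsto_mono[OF inf_le1 tendsto_divide_0[OF tendsto_const]])
         (rule filterlim_at_top_imp_at_infinity[OF filterlim_ident])
  qed simp
  have w: "w \<in> carrier (DD G \<nu> T)"
    using FR.cauchy_along_of_norm_tendsto_0[OF closed lim] w_t(2)
    by (auto simp: carrier_DD w_def syl_in_F_grp)
  have eval: "eval_DD w = g"
    using g w_t by (intro ext) (auto simp: \<pi>\<^sub>F_hom(2)[OF is_group] PiE_arb[OF g])
  show g': "g \<in> carrier (CC G \<nu> T)" using w eval by (auto simp: carrier_CC)
  have "CC_norm G \<nu> T g \<le> DD_norm G \<nu> T w"
    using metric_quotient_le[OF metric_quotient_DD_CC DD.pseudonormed_group_axioms w] eval by simp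
  then show "CC_norm G \<nu> T g = 0"
    using CC.norm_nonneg[OF g'] DD_norm_eqI[OF lim] by simp
qed

end

section \<open>Metric quotients with bounded kernel\<close>

text \<open>Since relabelling commutes with rescaling, the Lipschitz constant on the free product passes to
  Cauchy functions and to the limits of their norms.\<close>

lemma relabel_DD:
  assumes G: "directional_cone G \<nu> T" and H: "directional_cone H \<mu> T"
    and f: "f \<in> carrier G \<rightarrow> carrier H"
    and C: "C > 0" and lip: "\<And>g. g \<in> carrier G \<Longrightarrow> \<mu> (f g) \<le> C * \<nu> g"
    and w: "w \<in> carrier (DD G \<nu> T)"
  shows "(\<lambda>t\<in>T. relabel H f (w t)) \<in> carrier (DD H \<mu> T)"
    and "DD_norm H \<mu> T (\<lambda>t\<in>T. relabel H f (w t)) \<le> C * DD_norm G \<nu> T w"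
proof -
  interpret G: directional_cone G \<nu> T by fact
  interpret H: directional_cone H \<mu> T by fact
  interpret f: group_hom "FR G" "FR H" "relabel H f"
    using relabel_hom[OF f] by (simp add: group_hom_def group_hom_axioms_def group_FR)
  let ?w = "\<lambda>t\<in>T. relabel H f (w t)"
  have w_t: "w t \<in> carrier (F_grp G)" "w t \<in> carrier (FR G)" if "t \<in> T" for t
    using w that G.DD_in_FR by (auto simp: G.carrier_DD)
  have scaled: "\<psi> H (1 / t) (?w t) = relabel H f (\<psi> G (1 / t) (w t))" if "t \<in> T" for t
    using that w_t relabel_\<psi>[OF f] by simp
  have lip': "FR_norm H \<mu> (relabel H f x) \<le> C * FR_norm G \<nu> x" if "x \<in> carrier (FR G)" for x
    using relabel_lipschitz[where \<nu> = \<nu> and \<mu> = \<mu>, OF f G.norm_nonneg H.norm_nonneg C lip that] .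
  have dist: "norm_dist (FR H) (FR_norm H \<mu>) (\<psi> H (1 / t) (?w t)) (\<psi> H (1 / t') (?w t'))
      \<le> C * norm_dist (FR G) (FR_norm G \<nu>) (\<psi> G (1 / t) (w t)) (\<psi> G (1 / t') (w t'))"
    if "t \<in> T" "t' \<in> T" for t t'
    using lip'[of "inv\<^bsub>FR G\<^esub> \<psi> G (1 / t) (w t) \<otimes>\<^bsub>FR G\<^esub> \<psi> G (1 / t') (w t')"] that w_t
    unfolding norm_dist_def scaled[OF that(1)] scaled[OF that(2)] by simp
  have "cauchy_along (FR H) (FR_norm H \<mu>) T (\<lambda>t. \<psi> H (1 / t) (?w t))"
    unfolding cauchy_along_def
  proof (intro allI impI)
    fix e :: real assume "e > 0"
    then have "e / C > 0" using C by simp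
    then obtain M where M: "\<And>t t'. t \<in> T \<Longrightarrow> t' \<in> T \<Longrightarrow> t \<ge> M \<Longrightarrow> t' \<ge> M \<Longrightarrow>
        norm_dist (FR G) (FR_norm G \<nu>) (\<psi> G (1 / t) (w t)) (\<psi> G (1 / t') (w t')) < e / C"
      using w unfolding G.carrier_DD cauchy_along_def by blast
    have "norm_dist (FR H) (FR_norm H \<mu>) (\<psi> H (1 / t) (?w t)) (\<psi> H (1 / t') (?w t')) < e"
      if "t \<in> T" "t' \<in> T" "t \<ge> M" "t' \<ge> M" for t t'
      using M[OF that] dist[OF that(1,2)] C by (simp only: less_divide_eq mult.commute) simp
    then show "\<exists>M. \<forall>t\<in>T. \<forall>t'\<in>T. t \<ge> M \<longrightarrow> t' \<ge> M \<longrightarrow>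
        norm_dist (FR H) (FR_norm H \<mu>) (\<psi> H (1 / t) (?w t)) (\<psi> H (1 / t') (?w t')) < e"
      by blast
  qed
  then show w': "?w \<in> carrier (DD H \<mu> T)"
    using w_t(1) relabel_F_grp_closed[OF f] by (simp add: H.carrier_DD)
  show "DD_norm H \<mu> T ?w \<le> C * DD_norm G \<nu> T w"
  proof (rule tendsto_le[OF G.lim_T_nontrivial tendsto_mult_left[OF G.DD_norm_tendsto[OF w]] H.DD_norm_tendsto[OF w']])
    show "eventually (\<lambda>t. FR_norm H \<mu> (\<psi> H (1 / t) (?w t)) \<le> C * FR_norm G \<nu> (\<psi> G (1 / t) (w t)))
        (inf at_top (principal T))"
    proof (rule G.eventually_lim_T)
      fix t assume t: "t \<in> T"
      show "FR_norm H \<mu> (\<psi> H (1 / t) (?w t)) \<le> C * FR_norm G \<nu> (\<psi> G (1 / t) (w t))"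
        unfolding scaled[OF t] using lip' w_t t by simp
    qed
  qed
qed

locale bounded_quotient = G: directional_cone G \<nu> T + H: directional_cone H \<mu> T
  for G :: "('a, 'm) monoid_scheme" and \<nu> and H :: "('b, 'n) monoid_scheme" and \<mu> and T +
  fixes \<pi> :: "'a \<Rightarrow> 'b"
  assumes definite: "h \<in> carrier H \<Longrightarrow> \<mu> h = 0 \<Longrightarrow> h = \<one>\<^bsub>H\<^esub>"
    and quot: "metric_quotient G \<nu> H \<mu> \<pi>"
    and bounded: "bounded_kernel G \<nu> H \<pi>"
begin

sublocale \<pi>: group_hom G H \<pi>
  using quot by unfold_locales (simp add: metric_quotient_def epi_def)

abbreviation cone_fun :: "(real \<Rightarrow> 'a) \<Rightarrow> real \<Rightarrow> 'b" where
  "cone_fun g \<equiv> (\<lambda>t\<in>T. \<pi> (g t))"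

text \<open>Definiteness of \<open>\<mu>\<close> enters here: where \<open>\<mu>\<close> vanishes the multiplicative bound leaves no room,
  so the fibre has to contain an element of norm zero.\<close>

lemma almost_isometric_section:
  assumes "\<epsilon> > 0"
  obtains s where "\<And>h. h \<in> carrier H \<Longrightarrow> s h \<in> carrier G \<and> \<pi> (s h) = h \<and> \<nu> (s h) \<le> (1 + \<epsilon>) * \<mu> h"
proof -
  have "\<exists>g. g \<in> carrier G \<and> \<pi> g = h \<and> \<nu> g \<le> (1 + \<epsilon>) * \<mu> h" if h: "h \<in> carrier H" for h
  proof (cases "\<mu> h = 0")
    case True
    then have "h = \<one>\<^bsub>H\<^esub>" using definite h by blast
    then show ?thesis
      using G.norm_one H.norm_one by (intro exI[of _ "\<one>\<^bsub>G\<^esub>"]) simp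
  next
    case False
    then have "\<mu> h > 0" using H.norm_nonneg[OF h] by simp
    then have "\<mu> h < (1 + \<epsilon>) * \<mu> h" using assms by (simp add: distrib_right)
    then show ?thesis
      using metric_quotient_lift[OF quot G.pseudonormed_group_axioms h] by (metis less_imp_le)
  qed
  then show ?thesis using that by metis
qed

text \<open>Relabelling by \<open>\<pi>\<close> turns representatives of \<open>g\<close> into representatives of \<open>\<pi> \<circ> g\<close>.\<close>

lemma cone_fun_nonexpanding:
  assumes "g \<in> carrier (CC G \<nu> T)"
  shows "cone_fun g \<in> carrier (CC H \<mu> T)" and "CC_norm H \<mu> T (cone_fun g) \<le> CC_norm G \<nu> T g"
proof -
  have \<pi>: "\<pi> \<in> carrier G \<rightarrow> carrier H" by auto
  have lip: "\<mu> (\<pi> g) \<le> 1 * \<nu> g" if "g \<in> carrier G" for g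
    using metric_quotient_le[OF quot G.pseudonormed_group_axioms that] by simp
  have push: "\<exists>v\<in>carrier (DD H \<mu> T). H.eval_DD v = cone_fun (G.eval_DD w) \<and> DD_norm H \<mu> T v \<le> DD_norm G \<nu> T w"
    if w: "w \<in> carrier (DD G \<nu> T)" for w
  proof (intro bexI[of _ "\<lambda>t\<in>T. relabel H \<pi> (w t)"] conjI)
    note * = relabel_DD[OF G.directional_cone_axioms H.directional_cone_axioms \<pi> _ lip w]
    show "(\<lambda>t\<in>T. relabel H \<pi> (w t)) \<in> carrier (DD H \<mu> T)"
      "DD_norm H \<mu> T (\<lambda>t\<in>T. relabel H \<pi> (w t)) \<le> DD_norm G \<nu> T w"
      using * by simp_all
    have "(\<pi>\<^sub>F H \<circ> relabel H \<pi>) x = (\<pi> \<circ> \<pi>\<^sub>F G) x" if "x \<in> carrier (F_grp G)" for x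
    proof (rule F_grp_hom_eqI[OF _ _ H.is_group _ that])
      show "\<pi>\<^sub>F H \<circ> relabel H \<pi> \<in> hom (F_grp G) H"
        by (rule Group.hom_compose[OF relabel_hom_F_grp[OF \<pi>] \<pi>\<^sub>F_hom(1)[OF H.is_group]])
      show "\<pi> \<circ> \<pi>\<^sub>F G \<in> hom (F_grp G) H"
        by (rule Group.hom_compose[OF \<pi>\<^sub>F_hom(1)[OF G.is_group] \<pi>.homh])
    qed (simp add: relabel_syl[OF \<pi>] \<pi>\<^sub>F_hom(2) G.is_group H.is_group)
    then show "H.eval_DD (\<lambda>t\<in>T. relabel H \<pi> (w t)) = cone_fun (G.eval_DD w)"
      using G.DD_in_F[OF w] by (simp cong: restrict_cong)
  qed
  obtain w where w: "w \<in> carrier (DD G \<nu> T)" "G.eval_DD w = g" using assms by (auto simp: G.carrier_CC)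
  obtain v where "v \<in> carrier (DD H \<mu> T)" "H.eval_DD v = cone_fun g"
    using push[OF w(1)] unfolding w(2) by blast
  then show "cone_fun g \<in> carrier (CC H \<mu> T)"
    unfolding H.carrier_CC by (metis imageI)
  show "CC_norm H \<mu> T (cone_fun g) \<le> CC_norm G \<nu> T g"
  proof (rule field_le_epsilon)
    fix e :: real assume "e > 0"
    then obtain w where w: "w \<in> carrier (DD G \<nu> T)" "G.eval_DD w = g" "DD_norm G \<nu> T w < CC_norm G \<nu> T g + e"
      using metric_quotient_lift[OF G.metric_quotient_DD_CC G.DD.pseudonormed_group_axioms assms, of "CC_norm G \<nu> T g + e"]
      by auto
    then obtain v where v: "v \<in> carrier (DD H \<mu> T)" "H.eval_DD v = cone_fun g" "DD_norm H \<mu> T v \<le> DD_norm G \<nu> T w"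
      using push[OF w(1)] by auto
    then show "CC_norm H \<mu> T (cone_fun g) \<le> CC_norm G \<nu> T g + e"
      using metric_quotient_le[OF H.metric_quotient_DD_CC H.DD.pseudonormed_group_axioms v(1)] w(3) by simp
  qed
qed

text \<open>Conversely, relabelling by a section turns a representative of \<open>h\<close> into one of a lift of \<open>h\<close>,
  and the norm grows by a factor as close to 1 as desired.  The section is not multiplicative, but
  \<open>\<pi>\<close> undoes it on the generators of the free group, and hence on all words.\<close>

lemma cone_fun_lift:
  assumes h: "h \<in> carrier (CC H \<mu> T)" and c: "CC_norm H \<mu> T h < c"
  obtains g where "g \<in> carrier (CC G \<nu> T)" "cone_fun g = h" "CC_norm G \<nu> T g < c"
proof -
  obtain v where v: "v \<in> carrier (DD H \<mu> T)" "H.eval_DD v = h" "DD_norm H \<mu> T v < c"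
    using metric_quotient_lift[OF H.metric_quotient_DD_CC H.DD.pseudonormed_group_axioms h, OF c] by blast
  (* Choose the factor so close to 1 that the strict inequality survives; the denominator N + 1
     also covers N = 0. *)
  obtain \<epsilon> where \<epsilon>: "\<epsilon> > 0" "(1 + \<epsilon>) * DD_norm H \<mu> T v < c"
  proof
    define N where "N = DD_norm H \<mu> T v"
    have N: "0 \<le> N" "N < c" using v(3) H.DD.norm_nonneg[OF v(1)] by (auto simp: N_def)
    show "(c - N) / (N + 1) > 0" using N by simp
    have "(c - N) / (N + 1) * N < c - N" using N by (simp add: field_simps)
    then show "(1 + (c - N) / (N + 1)) * DD_norm H \<mu> T v < c"
      unfolding N_def[symmetric] distrib_right by simp
  qed
  obtain s where s: "\<And>h. h \<in> carrier H \<Longrightarrow> s h \<in> carrier G \<and> \<pi> (s h) = h \<and> \<nu> (s h) \<le> (1 + \<epsilon>) * \<mu> h"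
    using almost_isometric_section[OF \<epsilon>(1)] by blast
  then have s': "s \<in> carrier H \<rightarrow> carrier G" by auto
  define w where "w = (\<lambda>t\<in>T. relabel G s (v t))"
  have w: "w \<in> carrier (DD G \<nu> T)" "DD_norm G \<nu> T w \<le> (1 + \<epsilon>) * DD_norm H \<mu> T v"
    unfolding w_def using s \<epsilon>(1)
      relabel_DD[where C = "1 + \<epsilon>", OF H.directional_cone_axioms G.directional_cone_axioms s' _ _ v(1)]
    by auto
  have "(\<pi> \<circ> (\<pi>\<^sub>F G \<circ> relabel G s)) x = \<pi>\<^sub>F H x" if "x \<in> carrier (F_grp H)" for x
  proof (rule F_grp_hom_eqI[OF _ \<pi>\<^sub>F_hom(1)[OF H.is_group] H.is_group _ that])
    show "\<pi> \<circ> (\<pi>\<^sub>F G \<circ> relabel G s) \<in> hom (F_grp H) H"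
      by (rule Group.hom_compose[OF Group.hom_compose[OF relabel_hom_F_grp[OF s'] \<pi>\<^sub>F_hom(1)[OF G.is_group]] \<pi>.homh])
  qed (use s in \<open>simp add: relabel_syl[OF s'] \<pi>\<^sub>F_hom(2) G.is_group H.is_group\<close>)
  then have "cone_fun (G.eval_DD w) = H.eval_DD v"
    using H.DD_in_F[OF v(1)] by (simp add: w_def cong: restrict_cong)
  moreover have "CC_norm G \<nu> T (G.eval_DD w) < c"
    using metric_quotient_le[OF G.metric_quotient_DD_CC G.DD.pseudonormed_group_axioms w(1)] w(2) \<epsilon>(2) by simp
  ultimately show ?thesis
    using that[of "G.eval_DD w"] w(1) v(2) by (auto simp: G.carrier_CC)
qed

lemma cone_fun_epi: "cone_fun \<in> epi (CC G \<nu> T) (CC H \<mu> T)"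
proof -
  have "h \<in> cone_fun ` carrier (CC G \<nu> T)" if "h \<in> carrier (CC H \<mu> T)" for h
    using cone_fun_lift[OF that less_add_one] by blast
  moreover have "cone_fun \<in> hom (CC G \<nu> T) (CC H \<mu> T)"
    by (rule homI) (auto simp: cone_fun_nonexpanding G.CC_simps H.CC_simps G.CC_in_G)
  ultimately show ?thesis using cone_fun_nonexpanding(1) by (auto simp: epi_def)
qed

text \<open>The lift of \<open>\<pi> \<circ> g\<close> from \<open>cone_fun_lift\<close> need not be \<open>g\<close>, but it differs from \<open>g\<close> by a function with
  values in the bounded kernel, which has norm zero.\<close>

lemma CC_norm_cone_fun:
  assumes g: "g \<in> carrier (CC G \<nu> T)"
  shows "CC_norm H \<mu> T (cone_fun g) = CC_norm G \<nu> T g"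
proof (rule antisym)
  show "CC_norm H \<mu> T (cone_fun g) \<le> CC_norm G \<nu> T g" by (rule cone_fun_nonexpanding(2)[OF g])
  show "CC_norm G \<nu> T g \<le> CC_norm H \<mu> T (cone_fun g)"
  proof (rule field_le_epsilon)
    fix e :: real assume "e > 0"
    then obtain g' where g': "g' \<in> carrier (CC G \<nu> T)" "cone_fun g' = cone_fun g"
        "CC_norm G \<nu> T g' < CC_norm H \<mu> T (cone_fun g) + e"
      using cone_fun_lift[OF cone_fun_nonexpanding(1)[OF g], of "CC_norm H \<mu> T (cone_fun g) + e"] by auto
    define k where "k = g \<otimes>\<^bsub>CC G \<nu> T\<^esub> inv\<^bsub>CC G \<nu> T\<^esub> g'"
    obtain K where K: "\<And>x. x \<in> kernel G H \<pi> \<Longrightarrow> \<nu> x \<le> K"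
      using bounded by (auto simp: bounded_kernel_def)
    have k_t: "k t \<in> kernel G H \<pi>" if t: "t \<in> T" for t
    proof -
      have "\<pi> (g' t) = \<pi> (g t)" using fun_cong[OF g'(2), of t] t by simp
      then show ?thesis
        using t g g'(1) G.CC_in_G by (simp add: k_def G.CC_simps G.inv_CC kernel_def)
    qed
    have "k \<in> T \<rightarrow>\<^sub>E carrier G"
      using k_t by (auto simp: kernel_def) (simp add: k_def G.CC_simps)
    then have "k \<in> carrier (CC G \<nu> T)" "CC_norm G \<nu> T k = 0"
      using G.CC_norm_bounded K k_t by blast+
    moreover have "g = k \<otimes>\<^bsub>CC G \<nu> T\<^esub> g'"
      using g g'(1) by (simp add: k_def G.CC.m_assoc)
    ultimately have "CC_norm G \<nu> T g = CC_norm G \<nu> T g'"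
      using G.CC.norm_mult_null g'(1) by simp
    then show "CC_norm G \<nu> T g \<le> CC_norm H \<mu> T (cone_fun g) + e" using g'(3) by simp
  qed
qed

end

theorem corollary7p5:
  fixes G :: "('a, 'm) monoid_scheme" and H :: "('b, 'n) monoid_scheme"
    and \<nu> :: "'a \<Rightarrow> real" and \<mu> :: "'b \<Rightarrow> real"
    and T :: "real set" and \<pi> :: "'a \<Rightarrow> 'b"
  assumes "group G" and "conj_inv_norm G \<nu>"
    and "group H" and "conj_inv_norm H \<mu>"
    and "scaling_set T"
    and "metric_quotient G \<nu> H \<mu> \<pi>"
    and "bounded_kernel G \<nu> H \<pi>"
  shows "isometry (dir_cone G \<nu> T) (cone_norm G \<nu> T) (dir_cone H \<mu> T) (cone_norm H \<mu> T) (cone_map H \<mu> T \<pi>) \<and>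
    (\<forall>g\<in>carrier (CC G \<nu> T).
       cone_map H \<mu> T \<pi> (cone_class G \<nu> T g) = cone_class H \<mu> T (\<lambda>t\<in>T. \<pi> (g t)))"
proof -
  interpret G: pseudonormed_group G \<nu> by (rule conj_inv_norm_pseudonormed[OF assms(1,2)])
  interpret H: pseudonormed_group H \<mu> by (rule conj_inv_norm_pseudonormed[OF assms(3,4)])
  interpret bounded_quotient G \<nu> H \<mu> T \<pi>
    using assms by unfold_locales (auto simp: conj_inv_norm_def)
  note * = norm_preserving_epi_isometry[where f = cone_fun and \<nu> = "CC_norm G \<nu> T" and \<mu> = "CC_norm H \<mu> T",
      OF G.CC.pseudonormed_group_axioms H.CC.pseudonormed_group_axioms
      cone_fun_epi CC_norm_cone_fun, folded G.null_subgroup_eq H.null_subgroup_eq]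
  show ?thesis
    using * unfolding dir_cone_def cone_norm_def[abs_def] cone_map_def[abs_def] cone_class_def by blast
qed

end
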